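(* Write $\mathcal A^\epsilon(f,\lambda)$ and $\mathcal A^\epsilon_m(f,\lambda)$ for the numerical attractor and the truncated numerical attractor with external force $f\in\ell^2$ and damping constant $\lambda>\lambda^*$, the other parameters being fixed. (i) For every $\epsilon\in(0,\epsilon^*]$ and $m\in\mathbb N$, $$\|\mathcal A^\epsilon(f,\lambda)\|\le\frac{\|f\|}{\lambda-\lambda^*},\qquad \|\mathcal A^\epsilon_m(f,\lambda)\|\le\frac{\|f^m\|}{\lambda-\lambda^*}.$$ In particular, if $f=0$, then $\mathcal A^\epsilon(0,\lambda)=\mathcal A_m^\epsilon(0,\lambda)=\{0\}$. (ii) The following hold, where in each limit $\epsilon$ is any step size admissible for the current $(f,\lambda)$, i.e. $0<\epsilon\le\epsilon^*=\epsilon^*(f,\lambda)$: $$\lim_{f\to0}\rho(\mathcal A^\epsilon(f,\lambda),\{0\})=0,\qquad \lim_{f\to0}\rho(\mathcal A_m^\epsilon(f,\lambda),\{0\})=0,$$ $$\lim_{\lambda\to+\infty}\rho(\mathcal A^\epsilon(f,\lambda),\{0\})=0,\qquad \lim_{\lambda\to+\infty}\rho(\mathcal A_m^\epsilon(f,\lambda),\{0\})=0.$$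
   Context: $\ell^2$ is the Hilbert space of real square-summable sequences $u=(u_i)_{i\in\mathbb Z}$ with norm $\|u\|=(\sum_i u_i^2)^{1/2}$; $B_r=\{u\in\ell^2:\|u\|\le r\}$. Parameters: $\alpha,\beta,\nu,\lambda>0$, $\gamma\in(0,1)$, $f\in\ell^2$. $(\Lambda u)_i=-u_{i-1}+2u_i-u_{i+1}$, $(D^-u)_i=u_{i-1}-u_i$. Products are componentwise. $Fu=\nu\Lambda u-\alpha uD^-u+\beta u(1-u)(u-\gamma)-\lambda u+f$. Constants: $\lambda^*=4\nu+\frac{(2\alpha+\beta+\beta\gamma)^2}{4\beta}-\beta\gamma$; for $r>0$, $M_r=\beta r^3+(2\alpha+\beta+\beta\gamma)r^2+(4\nu+\beta\gamma+\lambda)r+\|f\|$, $L_r=4\nu+2\sqrt5\,r\alpha+\sqrt{12r^2(1+\gamma)^2+27r^4+3\gamma^2}\,\beta+\lambda$; $r^*=1+\frac{\|f\|}{\lambda-\lambda^*}$; $\epsilon^*=\min\left(\frac1{M_{r^*+1}},\frac1{1+L_{r^*+1}}\right)$ (these depend on $f$ and $\lambda$). $d(A,B)=\sup_{a\in A}\inf_{b\in B}\|a-b\|$, $\rho(A,B)=\max\{d(A,B),d(B,A)\}$ and $\|A\|=\rho(A,\{0\})$ for $A,B\subset\ell^2$ or $\mathbb R^{2m+1}$. For $\epsilon\in(0,\epsilon^*]$ and $y\in B_{r^*}$ the scheme $u_n^\epsilon=u_{n-1}^\epsilon+\epsilon Fu_n^\epsilon$, $u_0^\epsilon=y$, has a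 unique solution $u_n^\epsilon(y)\in B_{r^*}$; set $S_\epsilon(n)y=u_n^\epsilon(y)$. The numerical attractor is $\mathcal A^\epsilon=\bigcap_{k\in\mathbb N}\overline{\bigcup_{n\ge k}S_\epsilon(n)B_{r^*}}$, the unique compact subset of $B_{r^*}$ that is invariant under all $S_\epsilon(n)$ and satisfies $d(S_\epsilon(n)B_{r^*},\mathcal A^\epsilon)\to0$. Truncation: $\mathbb R^{2m+1}$ has coordinates indexed by $|i|\le m$ and Euclidean norm; $B_r^m$ is its closed ball of radius $r$ about $0$. $D_m^-$ is the matrix with $-1$ on the diagonal, $1$ on the first subdiagonal, $0$ elsewhere; $\Lambda_m=(D_m^-)^{\top}D_m^-$ is tridiagonal with off-diagonal entries $-1$ and diagonal $2,\dots,2,1$. $f^m=(f_i)_{|i|\le m}$, $F_mz=\nu\Lambda_mz-\alpha zD_m^-z+\beta z(1-z)(z-\gamma)-\lambda z+f^m$. For $y\in B^m_{r^*}$, $u_n^{\epsilon,m}(y)\in B^m_{r^*}$ is the unique solution of $u_n^{\epsilon,m}=u_{n-1}^{\epsilon,m}+\epsilon F_mu_n^{\epsilon,m}$, $u_0^{\epsilon,m}=y$, and the truncated numerical attractor is $\mathcal A_m^\epsilon=\bigcap_{N\ge1}\overline{\bigcup_{n\ge N}u_n^{\epsilon,m}(B^m_{r^*})}$. *)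

theory Defs
  imports "HOL-Analysis.Analysis"
begin

section \<open>The Hilbert space of square-summable bi-infinite sequences\<close>

definition square_summable :: "(int \<Rightarrow> real) \<Rightarrow> bool" where
  "square_summable u \<longleftrightarrow> (\<lambda>i. (u i)\<^sup>2) summable_on UNIV"

lemma square_summable_comparison:
  assumes "g summable_on UNIV" and "\<And>i. (u i)\<^sup>2 \<le> g i"
  shows "square_summable u"
  unfolding square_summable_def
  by (rule summable_on_comparison_test[OF assms(1)]) (use assms(2) in auto)

lemma square_summable_finite_support:
  assumes "finite {i. u i \<noteq> 0}"
  shows "square_summable u"
proof -
  have "(\<lambda>i. (u i)\<^sup>2) summable_on {i. u i \<noteq> 0}"
    using assms by simp
  then show ?thesis
    unfolding square_summable_def
    by (rule summable_on_cong_neutral[THEN iffD1, rotated -1]) auto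
qed

lemma square_summable_truncate:
  "square_summable (\<lambda>i. if \<bar>i\<bar> \<le> int m then u i else 0)"
  by (rule square_summable_finite_support, rule finite_subset[of _ "{- int m..int m}"])
    (auto split: if_splits)

lemma square_summable_scale:
  assumes "square_summable u"
  shows "square_summable (\<lambda>i. c * u i)"
  using summable_on_cmult_right[OF assms[unfolded square_summable_def], of "c\<^sup>2"]
  by (simp add: square_summable_def power_mult_distrib)

lemma square_summable_add:
  assumes "square_summable u" "square_summable v"
  shows "square_summable (\<lambda>i. u i + v i)"
proof (rule square_summable_comparison)
  show "(\<lambda>i. 2 * (u i)\<^sup>2 + 2 * (v i)\<^sup>2) summable_on UNIV"
    using assms by (intro summable_on_add summable_on_cmult_right) (auto simp: square_summable_def)
  fix i
  have "0 \<le> (u i - v i)\<^sup>2" by simp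
  then show "(u i + v i)\<^sup>2 \<le> 2 * (u i)\<^sup>2 + 2 * (v i)\<^sup>2"
    by (simp add: power2_eq_square algebra_simps)
qed

lemma square_summable_minus:
  "square_summable u \<Longrightarrow> square_summable (\<lambda>i. - u i)"
  by (simp add: square_summable_def)

lemma square_summable_diff:
  assumes "square_summable u" "square_summable v"
  shows "square_summable (\<lambda>i. u i - v i)"
  using square_summable_add[OF assms(1) square_summable_minus[OF assms(2)]] by simp

lemma product_summable:
  assumes "square_summable u" "square_summable v"
  shows "(\<lambda>i. u i * v i) summable_on UNIV"
proof (rule abs_summable_summable, rule Infinite_Sum.abs_summable_on_comparison_test')
  show "(\<lambda>i. (u i)\<^sup>2 + (v i)\<^sup>2) summable_on UNIV"
    using assms by (intro summable_on_add) (auto simp: square_summable_def)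
  fix i
  have "0 \<le> (\<bar>u i\<bar> - \<bar>v i\<bar>)\<^sup>2" by simp
  then have "2 * \<bar>u i * v i\<bar> \<le> (u i)\<^sup>2 + (v i)\<^sup>2"
    by (simp add: power2_eq_square algebra_simps abs_mult)
  then show "norm (u i * v i) \<le> (u i)\<^sup>2 + (v i)\<^sup>2"
    using abs_ge_zero[of "u i * v i"] unfolding real_norm_def by linarith
qed

lemma square_summable_bounded:
  assumes "square_summable u"
  shows "\<exists>C. \<forall>i. (u i)\<^sup>2 \<le> C"
proof (intro exI allI)
  fix i
  have "(\<Sum>\<^sub>\<infinity>j\<in>{i}. (u j)\<^sup>2) \<le> (\<Sum>\<^sub>\<infinity>j. (u j)\<^sup>2)"
    using assms by (intro infsum_mono_neutral) (auto simp: square_summable_def)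
  then show "(u i)\<^sup>2 \<le> (\<Sum>\<^sub>\<infinity>j. (u j)\<^sup>2)" by simp
qed

lemma square_summable_mult:
  assumes "square_summable u" "square_summable v"
  shows "square_summable (\<lambda>i. u i * v i)"
proof -
  obtain C where C: "\<And>i. (u i)\<^sup>2 \<le> C"
    using square_summable_bounded[OF assms(1)] by blast
  show ?thesis
  proof (rule square_summable_comparison)
    show "(\<lambda>i. C * (v i)\<^sup>2) summable_on UNIV"
      using assms(2) by (intro summable_on_cmult_right) (auto simp: square_summable_def)
    show "(u i * v i)\<^sup>2 \<le> C * (v i)\<^sup>2" for i
      using C[of i] by (simp add: power_mult_distrib mult_right_mono)
  qed
qed

lemma square_summable_shift:
  assumes "square_summable u"
  shows "square_summable (\<lambda>i. u (i + k))"
proof -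
  have "bij_betw (\<lambda>i. i + k) (UNIV :: int set) UNIV"
    by (rule bij_betwI[where g = "\<lambda>i. i - k"]) auto
  from summable_on_reindex_bij_betw[OF this, of "\<lambda>i. (u i)\<^sup>2"] show ?thesis
    using assms by (simp add: square_summable_def)
qed

typedef ell2 = "{u :: int \<Rightarrow> real. square_summable u}"
  morphisms coord Abs_ell2
  by (rule exI[where x = "\<lambda>_. 0"]) (simp add: square_summable_def)

setup_lifting type_definition_ell2

lemma square_summable_coord [simp]: "square_summable (coord u)"
  using coord[of u] by simp

lemma ell2_eqI: "(\<And>i. coord u i = coord v i) \<Longrightarrow> u = v"
  by (metis coord_inject ext)

instantiation ell2 :: real_inner
begin

lift_definition zero_ell2 :: ell2 is "\<lambda>_. 0"
  by (simp add: square_summable_def)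

lift_definition plus_ell2 :: "ell2 \<Rightarrow> ell2 \<Rightarrow> ell2" is "\<lambda>u v i. u i + v i"
  by (rule square_summable_add)

lift_definition minus_ell2 :: "ell2 \<Rightarrow> ell2 \<Rightarrow> ell2" is "\<lambda>u v i. u i - v i"
  by (rule square_summable_diff)

lift_definition uminus_ell2 :: "ell2 \<Rightarrow> ell2" is "\<lambda>u i. - u i"
  by (rule square_summable_minus)

lift_definition scaleR_ell2 :: "real \<Rightarrow> ell2 \<Rightarrow> ell2" is "\<lambda>c u i. c * u i"
  by (rule square_summable_scale)

definition inner_ell2 :: "ell2 \<Rightarrow> ell2 \<Rightarrow> real" where
  "inner_ell2 u v = (\<Sum>\<^sub>\<infinity>i. coord u i * coord v i)"

definition norm_ell2 :: "ell2 \<Rightarrow> real" where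
  "norm_ell2 u = sqrt (\<Sum>\<^sub>\<infinity>i. (coord u i)\<^sup>2)"

definition sgn_ell2 :: "ell2 \<Rightarrow> ell2" where
  "sgn_ell2 u = inverse (norm u) *\<^sub>R u"

definition dist_ell2 :: "ell2 \<Rightarrow> ell2 \<Rightarrow> real" where
  "dist_ell2 u v = norm (u - v)"

definition uniformity_ell2 :: "(ell2 \<times> ell2) filter" where
  "uniformity_ell2 = (INF e\<in>{0<..}. principal {(u, v). dist u v < e})"

definition open_ell2 :: "ell2 set \<Rightarrow> bool" where
  "open_ell2 U = (\<forall>u\<in>U. eventually (\<lambda>(u', v). u' = u \<longrightarrow> v \<in> U) uniformity)"

instance
proof
  fix u v w :: ell2 and a b :: real
  show "u + v + w = u + (v + w)" "u + v = v + u" "0 + u = u" "- u + u = 0" "u - v = u + - v"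
    "a *\<^sub>R (u + v) = a *\<^sub>R u + a *\<^sub>R v" "(a + b) *\<^sub>R u = a *\<^sub>R u + b *\<^sub>R u"
    "a *\<^sub>R b *\<^sub>R u = (a * b) *\<^sub>R u" "1 *\<^sub>R u = u"
    by (rule ell2_eqI; simp add: plus_ell2.rep_eq zero_ell2.rep_eq minus_ell2.rep_eq
        uminus_ell2.rep_eq scaleR_ell2.rep_eq algebra_simps)+
  show "dist u v = norm (u - v)" by (fact dist_ell2_def)
  show "sgn u = inverse (norm u) *\<^sub>R u" by (fact sgn_ell2_def)
  show "(uniformity :: (ell2 \<times> ell2) filter) = (INF e\<in>{0<..}. principal {(u, v). dist u v < e})"
    by (fact uniformity_ell2_def)
  show "open U = (\<forall>u\<in>U. \<forall>\<^sub>F (u', v) in uniformity. u' = u \<longrightarrow> v \<in> U)" for U :: "ell2 set"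
    by (fact open_ell2_def)
  show "inner u v = inner v u"
    by (simp add: inner_ell2_def mult.commute)
  show "inner (u + v) w = inner u w + inner v w"
    unfolding inner_ell2_def plus_ell2.rep_eq distrib_right
    by (intro infsum_add product_summable) simp_all
  show "inner (a *\<^sub>R u) v = a * inner u v"
    unfolding inner_ell2_def scaleR_ell2.rep_eq mult.assoc
    by (rule infsum_cmult_right')
  show "0 \<le> inner u u"
    unfolding inner_ell2_def by (rule infsum_nonneg) simp
  show "inner u u = 0 \<longleftrightarrow> u = 0"
  proof
    assume "inner u u = 0"
    then have *: "(\<Sum>\<^sub>\<infinity>i. coord u i * coord u i) = 0" by (simp add: inner_ell2_def)
    have "coord u i * coord u i = 0" for i
      by (rule nonneg_infsum_le_0D[where A = UNIV and f = "\<lambda>i. coord u i * coord u i"])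
        (use * in \<open>auto intro!: product_summable\<close>)
    then show "u = 0" by (intro ell2_eqI) (simp add: zero_ell2.rep_eq)
  qed (simp add: inner_ell2_def zero_ell2.rep_eq)
  show "norm u = sqrt (inner u u)"
    by (simp add: norm_ell2_def inner_ell2_def power2_eq_square)
qed

end


section \<open>The lattice nonlinearity\<close>

definition Lap :: "(int \<Rightarrow> real) \<Rightarrow> int \<Rightarrow> real" where
  "Lap u i = - u (i - 1) + 2 * u i - u (i + 1)"

definition Dminus :: "(int \<Rightarrow> real) \<Rightarrow> int \<Rightarrow> real" where
  "Dminus u i = u (i - 1) - u i"

lemma square_summable_Lap: "square_summable u \<Longrightarrow> square_summable (Lap u)"
  unfolding Lap_def diff_conv_add_uminus[of _ "1::int"]
  by (intro square_summable_add square_summable_diff square_summable_minus square_summable_scale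
      square_summable_shift)

lemma square_summable_Dminus: "square_summable u \<Longrightarrow> square_summable (Dminus u)"
  unfolding Dminus_def diff_conv_add_uminus[of _ "1::int"]
  by (intro square_summable_diff square_summable_shift)

lemma square_summable_cubic:
  assumes "square_summable u"
  shows "square_summable (\<lambda>i. \<beta> * (u i * (1 - u i) * (u i - \<gamma>)))"
proof -
  have "(\<lambda>i. u i * (1 - u i) * (u i - \<gamma>)) =
        (\<lambda>i. (1 + \<gamma>) * (u i * u i) - u i * (u i * u i) - \<gamma> * u i)"
    by (auto simp: algebra_simps)
  moreover have "square_summable \<dots>"
    using assms by (intro square_summable_scale square_summable_diff square_summable_mult)
  ultimately show ?thesis
    by (intro square_summable_scale) simp
qed

lift_definition F ::
  "real \<Rightarrow> real \<Rightarrow> real \<Rightarrow> real \<Rightarrow> real \<Rightarrow> ell2 \<Rightarrow> ell2 \<Rightarrow> ell2" is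
  "\<lambda>\<alpha> \<beta> \<nu> \<gamma> lam f u i.
     \<nu> * Lap u i - \<alpha> * (u i * Dminus u i) + \<beta> * (u i * (1 - u i) * (u i - \<gamma>))
       - lam * u i + f i"
  by (intro square_summable_add square_summable_diff square_summable_scale square_summable_Lap
      square_summable_mult square_summable_Dminus square_summable_cubic)


section \<open>The truncated nonlinearity\<close>

text \<open>The space of real vectors indexed by the integers \<open>i\<close> with \<open>\<bar>i\<bar> \<le> m\<close> is realised as the
  subspace \<open>vecs m\<close> of sequences vanishing outside these indices.  The norm inherited from \<open>ell2\<close>
  is the Euclidean one, see \<open>norm_vecs\<close> below.\<close>

definition vecs :: "nat \<Rightarrow> ell2 set" where
  "vecs m = {z. \<forall>i. int m < \<bar>i\<bar> \<longrightarrow> coord z i = 0}"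

lemma norm_vecs:
  assumes "z \<in> vecs m"
  shows "norm z = sqrt (\<Sum>i = - int m..int m. (coord z i)\<^sup>2)"
proof -
  have "(\<Sum>\<^sub>\<infinity>i. (coord z i)\<^sup>2) = (\<Sum>\<^sub>\<infinity>i\<in>{- int m..int m}. (coord z i)\<^sup>2)"
    using assms by (intro infsum_cong_neutral) (auto simp: vecs_def)
  then show ?thesis by (simp add: norm_ell2_def)
qed

lift_definition trunc :: "nat \<Rightarrow> ell2 \<Rightarrow> ell2" is
  "\<lambda>m f i. if \<bar>i\<bar> \<le> int m then f i else 0"
  by (rule square_summable_truncate)

text \<open>Entries of the matrices, with row and column index between \<open>- m\<close> and \<open>m\<close>.\<close>

definition Dmat :: "int \<Rightarrow> int \<Rightarrow> real" where
  "Dmat i j = (if i = j then - 1 else if i = j + 1 then 1 else 0)"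

definition Lapmat :: "nat \<Rightarrow> int \<Rightarrow> int \<Rightarrow> real" where
  "Lapmat m i j = (\<Sum>k = - int m..int m. Dmat k i * Dmat k j)"

definition mat_vec :: "nat \<Rightarrow> (int \<Rightarrow> int \<Rightarrow> real) \<Rightarrow> (int \<Rightarrow> real) \<Rightarrow> int \<Rightarrow> real" where
  "mat_vec m A z i = (\<Sum>j = - int m..int m. A i j * z j)"

lemma Lapmat_tridiagonal:
  assumes "\<bar>i\<bar> \<le> int m" "\<bar>j\<bar> \<le> int m"
  shows "Lapmat m i j =
    (if i = j then (if i = int m then 1 else 2) else if \<bar>i - j\<bar> = 1 then - 1 else 0)"
proof -
  have "Lapmat m i j = (\<Sum>k = - int m..int m.
      (if k = i then (if i = j then 1 else if i = j + 1 then - 1 else 0) else 0) +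
      (if k = i + 1 then (if i = j then 1 else if j = i + 1 then - 1 else 0) else 0))"
    unfolding Lapmat_def by (rule sum.cong) (auto simp: Dmat_def)
  also have "\<dots> = (if i = j then (if i = int m then 1 else 2) else if \<bar>i - j\<bar> = 1 then - 1 else 0)"
    using assms by (auto simp: sum.distrib)
  finally show ?thesis .
qed

lift_definition Ftrunc ::
  "nat \<Rightarrow> real \<Rightarrow> real \<Rightarrow> real \<Rightarrow> real \<Rightarrow> real \<Rightarrow> ell2 \<Rightarrow> ell2 \<Rightarrow> ell2" is
  "\<lambda>m \<alpha> \<beta> \<nu> \<gamma> lam f z i.
     if \<bar>i\<bar> \<le> int m then
       \<nu> * mat_vec m (Lapmat m) z i - \<alpha> * (z i * mat_vec m Dmat z i)
         + \<beta> * (z i * (1 - z i) * (z i - \<gamma>)) - lam * z i + f i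
     else 0"
  by (rule square_summable_truncate)


section \<open>Constants\<close>

definition lambda_star :: "real \<Rightarrow> real \<Rightarrow> real \<Rightarrow> real \<Rightarrow> real" where
  "lambda_star \<alpha> \<beta> \<nu> \<gamma> = 4 * \<nu> + (2 * \<alpha> + \<beta> + \<beta> * \<gamma>)\<^sup>2 / (4 * \<beta>) - \<beta> * \<gamma>"

definition M_const :: "real \<Rightarrow> real \<Rightarrow> real \<Rightarrow> real \<Rightarrow> real \<Rightarrow> ell2 \<Rightarrow> real \<Rightarrow> real" where
  "M_const \<alpha> \<beta> \<nu> \<gamma> lam f r =
     \<beta> * r ^ 3 + (2 * \<alpha> + \<beta> + \<beta> * \<gamma>) * r\<^sup>2 + (4 * \<nu> + \<beta> * \<gamma> + lam) * r + norm f"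

definition L_const :: "real \<Rightarrow> real \<Rightarrow> real \<Rightarrow> real \<Rightarrow> real \<Rightarrow> real \<Rightarrow> real" where
  "L_const \<alpha> \<beta> \<nu> \<gamma> lam r =
     4 * \<nu> + 2 * sqrt 5 * r * \<alpha>
       + sqrt (12 * r\<^sup>2 * (1 + \<gamma>)\<^sup>2 + 27 * r ^ 4 + 3 * \<gamma>\<^sup>2) * \<beta> + lam"

definition r_star :: "real \<Rightarrow> real \<Rightarrow> real \<Rightarrow> real \<Rightarrow> real \<Rightarrow> ell2 \<Rightarrow> real" where
  "r_star \<alpha> \<beta> \<nu> \<gamma> lam f = 1 + norm f / (lam - lambda_star \<alpha> \<beta> \<nu> \<gamma>)"

definition eps_star :: "real \<Rightarrow> real \<Rightarrow> real \<Rightarrow> real \<Rightarrow> real \<Rightarrow> ell2 \<Rightarrow> real" where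
  "eps_star \<alpha> \<beta> \<nu> \<gamma> lam f =
     min (1 / M_const \<alpha> \<beta> \<nu> \<gamma> lam f (r_star \<alpha> \<beta> \<nu> \<gamma> lam f + 1))
         (1 / (1 + L_const \<alpha> \<beta> \<nu> \<gamma> lam (r_star \<alpha> \<beta> \<nu> \<gamma> lam f + 1)))"


section \<open>Implicit Euler schemes and their attractors\<close>

text \<open>The solution is looked for among sequences staying in \<open>B\<close>, where it is unique for
  admissible step sizes.\<close>

definition implicit_euler ::
  "('a::real_vector \<Rightarrow> 'a) \<Rightarrow> 'a set \<Rightarrow> real \<Rightarrow> nat \<Rightarrow> 'a \<Rightarrow> 'a" where
  "implicit_euler G B \<epsilon> n y =
     (THE u :: nat \<Rightarrow> 'a. u 0 = y \<and> (\<forall>k\<ge>1. u k = u (k - 1) + \<epsilon> *\<^sub>R G (u k)) \<and> (\<forall>k. u k \<in> B)) n"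

definition numerical_attractor ::
  "real \<Rightarrow> real \<Rightarrow> real \<Rightarrow> real \<Rightarrow> real \<Rightarrow> ell2 \<Rightarrow> real \<Rightarrow> ell2 set" where
  "numerical_attractor \<alpha> \<beta> \<nu> \<gamma> lam f \<epsilon> =
     (let B = cball 0 (r_star \<alpha> \<beta> \<nu> \<gamma> lam f)
      in \<Inter>k. closure (\<Union>n\<in>{k..}. implicit_euler (F \<alpha> \<beta> \<nu> \<gamma> lam f) B \<epsilon> n ` B))"

definition truncated_attractor ::
  "nat \<Rightarrow> real \<Rightarrow> real \<Rightarrow> real \<Rightarrow> real \<Rightarrow> real \<Rightarrow> ell2 \<Rightarrow> real \<Rightarrow> ell2 set" where
  "truncated_attractor m \<alpha> \<beta> \<nu> \<gamma> lam f \<epsilon> =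
     (let B = cball 0 (r_star \<alpha> \<beta> \<nu> \<gamma> lam f) \<inter> vecs m
      in \<Inter>N\<in>{1..}. closure
           (\<Union>n\<in>{N..}. implicit_euler (Ftrunc m \<alpha> \<beta> \<nu> \<gamma> lam f) B \<epsilon> n ` B))"


section \<open>Hausdorff distance\<close>

text \<open>Values in \<open>ennreal\<close> make suprema and infima meaningful for all sets; in particular the
  distance from a nonempty set to the empty set is \<open>\<infinity>\<close>, not \<open>0\<close>.\<close>

definition semidist :: "'a::real_normed_vector set \<Rightarrow> 'a set \<Rightarrow> ennreal" where
  "semidist A B = (SUP a\<in>A. INF b\<in>B. ennreal (norm (a - b)))"

definition hausdorff :: "'a::real_normed_vector set \<Rightarrow> 'a set \<Rightarrow> ennreal" where
  "hausdorff A B = max (semidist A B) (semidist B A)"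

definition set_norm :: "'a::real_normed_vector set \<Rightarrow> ennreal" where
  "set_norm A = hausdorff A {0}"

end

theory Submission
  imports Defs "HOL-Complex_Analysis.Great_Picard"
begin

text \<open>
  Let \<open>\<kappa> = lam - lambda_star\<close>. The full and the truncated operator are two instances of one operator
  on sequences supported in a set \<open>S\<close> of sites. Testing an implicit step \<open>u = v + \<epsilon> *\<^sub>R G u\<close> against
  \<open>\<theta> i * u i\<close>, where the weights lie in \<open>[0, 1]\<close> and vary by at most \<open>\<delta>\<close> between neighbours, gives
  \<open>(1 + \<epsilon> \<kappa>) \<Sum> \<theta> u\<^sup>2 \<le> \<Sum> \<theta> v\<^sup>2 + \<epsilon> (\<Sum> \<theta> f\<^sup>2 / \<kappa> + C \<delta>)\<close>.
  With \<open>\<theta> = 1\<close> the orbits contract onto the ball of radius \<open>norm f / \<kappa>\<close>, which bounds the attractor.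
  A distance to the empty set is infinite, so the attractor must also be shown to be nonempty: with
  weights vanishing at the origin and equal to \<open>1\<close> far out, the inequality makes the tails of the orbit
  of \<open>0\<close> uniformly small, and that orbit has a limit point.
\<close>

section \<open>Square-summable sequences\<close>

text \<open>\<open>Lap\<close> is a nonnegative operator and enters with a plus sign, so diffusion
  feeds energy in; only the damping \<open>lam\<close> and the cubic oppose growth.
  \<open>lambda_star\<close> adds up the worst case at one site. Diffusion costs
  \<open>4 * \<nu>\<close>. Convection costs \<open>2 * \<alpha> * \<bar>y\<bar> ^ 3\<close> once
  the cube of the neighbour has been telescoped away; together with the cubic reaction this is
  \<open>y ^ 2\<close> times an expression bounded by a concave quadratic in
  \<open>\<bar>y\<bar>\<close>, whose maximum is the rest of \<open>lambda_star\<close>. Half of the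
  remaining rate \<kappa> pays for the force by Young's inequality.

  Since the step is tested against its new value, the energy inequality holds for every positive
  \<epsilon>; small steps are needed for solvability only. The contraction argument needs room, so
  it runs in the ball of radius \<open>r + 1\<close>, and the energy inequality then returns the
  solution to radius \<open>r\<close>. Radius and force are separate parameters because the
  truncated scheme keeps the radius and step bound of \<open>f\<close> while being driven by
  \<open>trunc m f\<close>.\<close>

lemmas coord_simps [simp] = plus_ell2.rep_eq zero_ell2.rep_eq minus_ell2.rep_eq
  uminus_ell2.rep_eq scaleR_ell2.rep_eq

lemma summable_coord_square [simp]: "(\<lambda>i. (coord u i)\<^sup>2) summable_on UNIV"
  using square_summable_coord[of u] by (simp add: square_summable_def)

lemma summable_coord_diff_square [simp]:
  "(\<lambda>i. (coord u i - coord v i)\<^sup>2) summable_on UNIV"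
  using summable_coord_square[of "u - v"] by simp

lemma norm_ell2_square: "(norm u)\<^sup>2 = (\<Sum>\<^sub>\<infinity>i. (coord u i)\<^sup>2)"
  by (simp add: norm_ell2_def infsum_nonneg)

lemma abs_coord_le_norm: "\<bar>coord u i\<bar> \<le> norm u"
proof -
  have "(coord u i)\<^sup>2 = (\<Sum>j\<in>{i}. (coord u j)\<^sup>2)" by simp
  also have "\<dots> \<le> (norm u)\<^sup>2"
    unfolding norm_ell2_square by (rule finite_sum_le_infsum) auto
  finally show ?thesis
    by (simp add: abs_le_square_iff[symmetric])
qed

lemma norm_ell2_mono:
  assumes "\<And>i. \<bar>coord u i\<bar> \<le> coord v i"
  shows "norm u \<le> norm v"
proof -
  have "(coord u i)\<^sup>2 \<le> (coord v i)\<^sup>2" for i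
    using assms[of i] by (metis abs_ge_zero power2_abs power_mono)
  then show ?thesis
    unfolding norm_ell2_def by (intro real_sqrt_le_mono infsum_mono) auto
qed

lemma continuous_coord: "continuous_on A (\<lambda>u. coord u i)"
proof -
  have "bounded_linear (\<lambda>u. coord u i)"
    by (rule bounded_linear_intro[where K = 1]) (auto simp: abs_coord_le_norm)
  then show ?thesis by (rule linear_continuous_on)
qed

text \<open>Coordinatewise limits exist, and the Cauchy bound passes to them on every finite set of
  sites, uniformly in that set. Completeness serves the contraction argument for one step and the
  limit point of the orbit of \<open>0\<close>.\<close>

instance ell2 :: banach
proof
  fix x :: "nat \<Rightarrow> ell2"
  assume "Cauchy x"
  have "\<exists>l. (\<lambda>n. coord (x n) i) \<longlonglongrightarrow> l" for i
  proof -
    have "Cauchy (\<lambda>n. coord (x n) i)"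
    proof (rule metric_CauchyI)
      fix e :: real assume "e > 0"
      then obtain N where N: "\<And>n k. n \<ge> N \<Longrightarrow> k \<ge> N \<Longrightarrow> dist (x n) (x k) < e"
        using \<open>Cauchy x\<close> by (metis metric_CauchyD)
      then show "\<exists>N. \<forall>n\<ge>N. \<forall>k\<ge>N. dist (coord (x n) i) (coord (x k) i) < e"
        using abs_coord_le_norm[of "_ - _" i]
        by (metis dist_norm real_norm_def minus_ell2.rep_eq le_less_trans)
    qed
    then show ?thesis by (simp add: Cauchy_convergent_iff convergent_def)
  qed
  then obtain l where l: "\<And>i. (\<lambda>n. coord (x n) i) \<longlonglongrightarrow> l i" by metis
  have est: "\<exists>N. \<forall>n\<ge>N. \<forall>A. finite A \<longrightarrow> (\<Sum>i\<in>A. (coord (x n) i - l i)\<^sup>2) \<le> e\<^sup>2" if "e > 0" for e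
  proof -
    obtain N where N: "\<And>n k. n \<ge> N \<Longrightarrow> k \<ge> N \<Longrightarrow> dist (x n) (x k) < e"
      using \<open>Cauchy x\<close> \<open>e > 0\<close> by (metis metric_CauchyD)
    have "(\<Sum>i\<in>A. (coord (x n) i - l i)\<^sup>2) \<le> e\<^sup>2" if "n \<ge> N" "finite A" for n A
    proof (rule LIMSEQ_le_const2)
      show "(\<lambda>k. \<Sum>i\<in>A. (coord (x n) i - coord (x k) i)\<^sup>2) \<longlonglongrightarrow> (\<Sum>i\<in>A. (coord (x n) i - l i)\<^sup>2)"
        by (intro tendsto_intros l)
      have "(\<Sum>i\<in>A. (coord (x n) i - coord (x k) i)\<^sup>2) \<le> e\<^sup>2" if "k \<ge> N" for k
      proof -
        have "(\<Sum>i\<in>A. (coord (x n - x k) i)\<^sup>2) \<le> (norm (x n - x k))\<^sup>2"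
          unfolding norm_ell2_square by (rule finite_sum_le_infsum) (use \<open>finite A\<close> in auto)
        also have "\<dots> \<le> e\<^sup>2"
          using N[OF \<open>n \<ge> N\<close> \<open>k \<ge> N\<close>] by (intro power_mono) (auto simp: dist_norm)
        finally show ?thesis by simp
      qed
      then show "\<exists>N. \<forall>k\<ge>N. (\<Sum>i\<in>A. (coord (x n) i - coord (x k) i)\<^sup>2) \<le> e\<^sup>2" by blast
    qed
    then show ?thesis by blast
  qed
  have summ: "square_summable (\<lambda>i. coord (x n) i - l i)"
    if "\<And>A. finite A \<Longrightarrow> (\<Sum>i\<in>A. (coord (x n) i - l i)\<^sup>2) \<le> c" for n c
    unfolding square_summable_def using that
    by (intro nonneg_bdd_above_summable_on bdd_aboveI[of _ c]) auto
  obtain n where n: "\<And>A. finite A \<Longrightarrow> (\<Sum>i\<in>A. (coord (x n) i - l i)\<^sup>2) \<le> 1\<^sup>2"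
    using est[of 1] by auto
  have "square_summable l"
    using square_summable_diff[OF square_summable_coord[of "x n"] summ[OF n]] by simp
  then have cl: "coord (Abs_ell2 l) = l" by (simp add: Abs_ell2_inverse)
  have "x \<longlonglongrightarrow> Abs_ell2 l"
  proof (rule metric_LIMSEQ_I)
    fix e :: real assume "e > 0"
    then obtain N where
      N: "\<And>n A. n \<ge> N \<Longrightarrow> finite A \<Longrightarrow> (\<Sum>i\<in>A. (coord (x n) i - l i)\<^sup>2) \<le> (e / 2)\<^sup>2"
      using est[of "e / 2"] by auto
    have "dist (x n) (Abs_ell2 l) < e" if "n \<ge> N" for n
    proof -
      have "(norm (x n - Abs_ell2 l))\<^sup>2 \<le> (e / 2)\<^sup>2"
        unfolding norm_ell2_square
      proof (rule infsum_le_finite_sums)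
        have "coord (x n - Abs_ell2 l) i = coord (x n) i - l i" for i by (simp add: cl)
        then show "(\<Sum>i\<in>A. (coord (x n - Abs_ell2 l) i)\<^sup>2) \<le> (e / 2)\<^sup>2" if "finite A" for A
          using N[OF \<open>n \<ge> N\<close> that] by (simp only:)
      qed (rule summable_coord_square)
      then have "norm (x n - Abs_ell2 l) \<le> e / 2"
        using \<open>e > 0\<close> by (auto intro: power2_le_imp_le)
      then show ?thesis using \<open>e > 0\<close> by (simp add: dist_norm)
    qed
    then show "\<exists>N. \<forall>n\<ge>N. dist (x n) (Abs_ell2 l) < e" by blast
  qed
  then show "convergent x" by (auto simp: convergent_def)
qed

definition ell2_on :: "int set \<Rightarrow> ell2 set" where
  "ell2_on S = {u. \<forall>i. i \<notin> S \<longrightarrow> coord u i = 0}"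

lemma ell2_on_UNIV [simp]: "ell2_on UNIV = UNIV"
  by (simp add: ell2_on_def)

lemma ell2_on_interval: "ell2_on {- int m..int m} = vecs m"
proof -
  have "i \<notin> {- int m..int m} \<longleftrightarrow> int m < \<bar>i\<bar>" for i by auto
  then show ?thesis by (simp add: ell2_on_def vecs_def)
qed

lemma closed_ell2_on: "closed (ell2_on S)"
proof -
  have "ell2_on S = (\<Inter>i\<in>- S. {u. coord u i = 0})" by (auto simp: ell2_on_def)
  then show ?thesis
    by (auto intro!: closed_INT closed_Collect_eq continuous_coord)
qed


section \<open>Weighted energies\<close>

definition wsum :: "(int \<Rightarrow> real) \<Rightarrow> ell2 \<Rightarrow> real" where
  "wsum \<theta> u = (\<Sum>\<^sub>\<infinity>i. \<theta> i * (coord u i)\<^sup>2)"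

definition slow_weight :: "real \<Rightarrow> (int \<Rightarrow> real) \<Rightarrow> bool" where
  "slow_weight \<delta> \<theta> \<longleftrightarrow> (\<forall>i. 0 \<le> \<theta> i \<and> \<theta> i \<le> 1 \<and> \<bar>\<theta> i - \<theta> (i - 1)\<bar> \<le> \<delta>)"

lemma wsum_summable:
  assumes "slow_weight \<delta> \<theta>"
  shows "(\<lambda>i. \<theta> i * (coord u i)\<^sup>2) summable_on UNIV"
  by (rule summable_on_comparison_test[OF summable_coord_square[of u]])
    (use assms in \<open>auto simp: slow_weight_def mult_left_le_one_le\<close>)

lemma wsum_nonneg: "slow_weight \<delta> \<theta> \<Longrightarrow> 0 \<le> wsum \<theta> u"
  unfolding wsum_def by (rule infsum_nonneg) (auto simp: slow_weight_def)

lemma wsum_one: "wsum (\<lambda>_. 1) u = (norm u)\<^sup>2"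
  by (simp add: wsum_def norm_ell2_square)

lemma summable_shift:
  fixes g :: "int \<Rightarrow> real"
  assumes "g summable_on UNIV"
  shows "(\<lambda>i. g (i + k)) summable_on UNIV" "(\<Sum>\<^sub>\<infinity>i. g (i + k)) = (\<Sum>\<^sub>\<infinity>i. g i)"
proof -
  have b: "bij_betw (\<lambda>i. i + k) (UNIV :: int set) UNIV"
    by (rule bij_betwI[where g = "\<lambda>i. i - k"]) auto
  from summable_on_reindex_bij_betw[OF b, of g] infsum_reindex_bij_betw[OF b, of g] assms
  show "(\<lambda>i. g (i + k)) summable_on UNIV" "(\<Sum>\<^sub>\<infinity>i. g (i + k)) = (\<Sum>\<^sub>\<infinity>i. g i)" by auto
qed

text \<open>A ramp in place of an indicator: its slope \<open>1 / k\<close> is the \<delta> of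
  \<open>slow_weight\<close>, so the error it causes in the energy inequality disappears as
  \<open>k\<close> grows.\<close>

definition tail_weight :: "real \<Rightarrow> int \<Rightarrow> real" where
  "tail_weight k i = min 1 (\<bar>real_of_int i\<bar> / k)"

lemma slow_weight_tail:
  assumes "k > 0"
  shows "slow_weight (1 / k) (tail_weight k)"
proof -
  have "\<bar>\<bar>real_of_int i\<bar> / k - \<bar>real_of_int (i - 1)\<bar> / k\<bar> \<le> 1 / k" for i
  proof -
    have "\<bar>\<bar>real_of_int i\<bar> / k - \<bar>real_of_int (i - 1)\<bar> / k\<bar> =
        \<bar>\<bar>real_of_int i\<bar> - \<bar>real_of_int (i - 1)\<bar>\<bar> / k"
      using assms by (simp only: diff_divide_distrib[symmetric] abs_divide abs_of_pos)
    also have "\<dots> \<le> 1 / k" using assms by (intro divide_right_mono) auto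
    finally show ?thesis .
  qed
  moreover have "\<bar>min 1 a - min 1 b\<bar> \<le> \<bar>a - b\<bar>" for a b :: real by linarith
  ultimately have "\<bar>tail_weight k i - tail_weight k (i - 1)\<bar> \<le> 1 / k" for i
    unfolding tail_weight_def by (rule order_trans[rotated])
  moreover have "0 \<le> tail_weight k i" "tail_weight k i \<le> 1" for i
    using assms by (auto simp: tail_weight_def)
  ultimately show ?thesis unfolding slow_weight_def by blast
qed

lemma wsum_tail_small:
  assumes "e > 0"
  shows "\<exists>K. \<forall>k>K. wsum (tail_weight k) u < e"
proof -
  obtain A where A: "finite A" "dist (\<Sum>i\<in>A. (coord u i)\<^sup>2) (\<Sum>\<^sub>\<infinity>i. (coord u i)\<^sup>2) \<le> e / 4"
    using infsum_finite_approximation[OF summable_coord_square[of u], of "e / 4"] assms by auto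
  \<comment> \<open>A bound for all \<open>\<bar>i\<bar>\<close> on \<open>A\<close> that also makes
    sense when \<open>A\<close> is empty.\<close>
  define J where "J = (\<Sum>i\<in>A. \<bar>real_of_int i\<bar>)"
  have J: "\<bar>real_of_int i\<bar> \<le> J" if "i \<in> A" for i
    unfolding J_def using that A(1) by (intro member_le_sum) auto
  have J0: "J \<ge> 0" unfolding J_def by (rule sum_nonneg) auto
  have smA: "(\<lambda>i. (coord u i)\<^sup>2) summable_on (- A)" "(\<lambda>i. (coord u i)\<^sup>2) summable_on A"
    by (auto intro: summable_on_subset_banach[OF summable_coord_square])
  have "(\<Sum>\<^sub>\<infinity>i\<in>-A. (coord u i)\<^sup>2) = (\<Sum>\<^sub>\<infinity>i. (coord u i)\<^sup>2) - (\<Sum>i\<in>A. (coord u i)\<^sup>2)"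
    using infsum_Un_disjoint[OF smA(2,1)] A(1) by auto
  also have "\<dots> \<le> e / 4" using A(2) unfolding dist_real_def by linarith
  finally have rest: "(\<Sum>\<^sub>\<infinity>i\<in>-A. (coord u i)\<^sup>2) \<le> e / 4" .
  \<comment> \<open>On \<open>A\<close> the weight is at most \<open>J / k\<close>. The product in
    the threshold makes \<open>J / k\<close> times the squared norm at most \<open>e / 4\<close>;
    the final \<open>+ 1\<close> makes \<open>k\<close> positive.\<close>
  have "wsum (tail_weight k) u < e" if k: "k > (J + 1) * ((norm u)\<^sup>2 + 1) * (4 / e) + 1" for k
  proof -
    have "0 \<le> (J + 1) * ((norm u)\<^sup>2 + 1) * (4 / e)" using J0 assms by auto
    with k have k0: "k > 0" and k1: "k > (J + 1) * ((norm u)\<^sup>2 + 1) * (4 / e)" by auto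
    have "wsum (tail_weight k) u =
        (\<Sum>\<^sub>\<infinity>i\<in>A. tail_weight k i * (coord u i)\<^sup>2) + (\<Sum>\<^sub>\<infinity>i\<in>-A. tail_weight k i * (coord u i)\<^sup>2)"
      unfolding wsum_def
      by (subst infsum_Un_disjoint[symmetric])
        (auto intro: summable_on_subset_banach[OF wsum_summable[OF slow_weight_tail[OF k0]]])
    also have "(\<Sum>\<^sub>\<infinity>i\<in>-A. tail_weight k i * (coord u i)\<^sup>2) \<le> (\<Sum>\<^sub>\<infinity>i\<in>-A. (coord u i)\<^sup>2)"
      using slow_weight_tail[OF k0]
      by (intro infsum_mono smA summable_on_subset_banach[OF wsum_summable[OF slow_weight_tail[OF k0]]])
        (auto simp: slow_weight_def mult_left_le_one_le)
    also have "(\<Sum>\<^sub>\<infinity>i\<in>A. tail_weight k i * (coord u i)\<^sup>2) \<le> (\<Sum>i\<in>A. J / k * (coord u i)\<^sup>2)"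
    proof -
      have "tail_weight k i \<le> J / k" if "i \<in> A" for i
        using divide_right_mono[OF J[OF that], of k] k0 by (simp add: tail_weight_def)
      then have "(\<Sum>i\<in>A. tail_weight k i * (coord u i)\<^sup>2) \<le> (\<Sum>i\<in>A. J / k * (coord u i)\<^sup>2)"
        by (intro sum_mono mult_right_mono) auto
      then show ?thesis using A(1) by simp
    qed
    also have "\<dots> \<le> J / k * (norm u)\<^sup>2"
      unfolding sum_distrib_left[symmetric] norm_ell2_square using A(1) J0 k0
      by (intro mult_left_mono finite_sum_le_infsum) auto
    also have "J / k * (norm u)\<^sup>2 \<le> e / 4"
    proof -
      have "J * (norm u)\<^sup>2 \<le> (J + 1) * ((norm u)\<^sup>2 + 1)"
        using J0 by (intro mult_mono) auto
      also have "\<dots> \<le> e / 4 * k" using k1 assms by (simp add: field_simps)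
      finally show ?thesis using k0 by (simp add: field_simps)
    qed
    finally show ?thesis using rest assms by linarith
  qed
  then show ?thesis by blast
qed

text \<open>Boundedness gives a coordinatewise convergent subsequence; uniformly small tails make it
  Cauchy in norm.\<close>

lemma uniform_tails_convergent_subsequence:
  fixes x :: "nat \<Rightarrow> ell2"
  assumes bdd: "\<And>n. norm (x n) \<le> R"
    and tails: "\<And>e. e > 0 \<Longrightarrow> \<exists>k>0. \<forall>n. wsum (tail_weight k) (x n) \<le> e"
  obtains l s where "strict_mono s" "(\<lambda>n. x (s n)) \<longlonglongrightarrow> l"
proof -
  have "norm (coord (x n) i) \<le> R" for n i
    using bdd[of n] abs_coord_le_norm[of "x n" i] by simp
  \<comment> \<open>Diagonal extraction over the countably many sites, as in the Arzela-Ascoli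
    theorem.\<close>
  then obtain s where s: "strict_mono s" "\<And>i. \<exists>l. (\<lambda>n. coord (x (s n)) i) \<longlonglongrightarrow> l"
    using function_convergent_subsequence[of UNIV "\<lambda>n. coord (x n)" R] by (metis UNIV_I countableI_type)
  then obtain l where l: "\<And>i. (\<lambda>n. coord (x (s n)) i) \<longlonglongrightarrow> l i" by metis
  have "Cauchy (\<lambda>n. x (s n))"
  proof (rule metric_CauchyI)
    fix e :: real assume "e > 0"
    \<comment> \<open>Budget: two tail terms and two terms on the finite block, each at most
      \<open>e ^ 2 / 16\<close> and each doubled by \<open>sq\<close>, give less than
      \<open>e ^ 2 / 2\<close>.\<close>
    then obtain k where k: "k > 0" "\<And>n. wsum (tail_weight k) (x n) \<le> e\<^sup>2 / 16"
      using tails[of "e\<^sup>2 / 16"] by auto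
    define A where "A = {- \<lceil>k\<rceil>..\<lceil>k\<rceil>}"
    have wA: "tail_weight k i = 1" if "i \<notin> A" for i
    proof -
      from that have "\<bar>real_of_int i\<bar> \<ge> k" unfolding A_def by (auto simp: not_le) linarith+
      then show ?thesis using \<open>k > 0\<close> by (simp add: tail_weight_def)
    qed
    have "(\<lambda>n. \<Sum>i\<in>A. (coord (x (s n)) i - l i)\<^sup>2) \<longlonglongrightarrow> (\<Sum>i\<in>A. (l i - l i)\<^sup>2)"
      by (intro tendsto_intros l)
    then have "\<forall>\<^sub>F n in sequentially. (\<Sum>i\<in>A. (coord (x (s n)) i - l i)\<^sup>2) < e\<^sup>2 / 16"
      using \<open>e > 0\<close> by (intro order_tendstoD) auto
    then obtain N where N: "\<And>n. n \<ge> N \<Longrightarrow> (\<Sum>i\<in>A. (coord (x (s n)) i - l i)\<^sup>2) < e\<^sup>2 / 16"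
      unfolding eventually_sequentially by blast
    have "dist (x (s n)) (x (s m)) < e" if "n \<ge> N" "m \<ge> N" for n m
    proof -
      define p q where "p = x (s n)" and "q = x (s m)"
      have sq: "(a - b)\<^sup>2 \<le> 2 * a\<^sup>2 + 2 * b\<^sup>2" for a b :: real
        using zero_le_power2[of "a + b"] by (simp add: power2_eq_square algebra_simps)
      have sw: "slow_weight (1 / k) (tail_weight k)" using slow_weight_tail[OF \<open>k > 0\<close>] .
      have ind: "(\<lambda>i. if i \<in> A then (coord p i - coord q i)\<^sup>2 else 0) summable_on UNIV"
        by (rule summable_on_comparison_test[OF summable_coord_square[of "p - q"]]) auto
      \<comment> \<open>On \<open>A\<close> the difference itself is kept; off \<open>A\<close> the
        weight is \<open>1\<close>, so the weighted energies of \<open>p\<close> and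
        \<open>q\<close> dominate it.\<close>
      have "(norm (p - q))\<^sup>2 \<le> (\<Sum>\<^sub>\<infinity>i. (if i \<in> A then (coord p i - coord q i)\<^sup>2 else 0)
            + (2 * (tail_weight k i * (coord p i)\<^sup>2) + 2 * (tail_weight k i * (coord q i)\<^sup>2)))"
        unfolding norm_ell2_square
      proof (rule infsum_mono)
        show "(\<lambda>i. (if i \<in> A then (coord p i - coord q i)\<^sup>2 else 0)
            + (2 * (tail_weight k i * (coord p i)\<^sup>2) + 2 * (tail_weight k i * (coord q i)\<^sup>2)))
            summable_on UNIV"
          by (intro summable_on_add summable_on_cmult_right ind wsum_summable[OF sw])
        fix i
        have "tail_weight k i \<ge> 0" using sw by (simp add: slow_weight_def)
        then show "(coord (p - q) i)\<^sup>2 \<le> (if i \<in> A then (coord p i - coord q i)\<^sup>2 else 0)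
            + (2 * (tail_weight k i * (coord p i)\<^sup>2) + 2 * (tail_weight k i * (coord q i)\<^sup>2))"
          using sq[of "coord p i" "coord q i"] wA[of i] by auto
      qed simp
      also have "\<dots> = (\<Sum>\<^sub>\<infinity>i. if i \<in> A then (coord p i - coord q i)\<^sup>2 else 0)
          + (2 * wsum (tail_weight k) p + 2 * wsum (tail_weight k) q)"
        unfolding wsum_def infsum_cmult_right'[symmetric]
        by (subst infsum_add; (intro summable_on_add summable_on_cmult_right ind wsum_summable[OF sw])?)
          (subst infsum_add; (intro summable_on_cmult_right wsum_summable[OF sw])?; simp)
      finally have pq: "(norm (p - q))\<^sup>2 \<le>
          (\<Sum>\<^sub>\<infinity>i. if i \<in> A then (coord p i - coord q i)\<^sup>2 else 0)
          + (2 * wsum (tail_weight k) p + 2 * wsum (tail_weight k) q)" .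
      have "(\<Sum>\<^sub>\<infinity>i. if i \<in> A then (coord p i - coord q i)\<^sup>2 else 0)
          = (\<Sum>\<^sub>\<infinity>i\<in>A. (coord p i - coord q i)\<^sup>2)"
        by (rule infsum_cong_neutral) auto
      also have "\<dots> = (\<Sum>i\<in>A. (coord p i - coord q i)\<^sup>2)" by (simp add: A_def)
      also have "\<dots> \<le> (\<Sum>i\<in>A. 2 * (coord p i - l i)\<^sup>2 + 2 * (coord q i - l i)\<^sup>2)"
      proof (rule sum_mono)
        fix i
        show "(coord p i - coord q i)\<^sup>2 \<le> 2 * (coord p i - l i)\<^sup>2 + 2 * (coord q i - l i)\<^sup>2"
          using sq[of "coord p i - l i" "coord q i - l i"] by simp
      qed
      also have "\<dots> = 2 * (\<Sum>i\<in>A. (coord p i - l i)\<^sup>2) + 2 * (\<Sum>i\<in>A. (coord q i - l i)\<^sup>2)"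
        by (simp add: sum.distrib sum_distrib_left)
      finally have "(norm (p - q))\<^sup>2 < e\<^sup>2"
        using pq N[OF that(1)] N[OF that(2)] k(2)[of "s n"] k(2)[of "s m"] zero_less_power[OF \<open>e > 0\<close>, of 2]
        unfolding p_def q_def by linarith
      then show ?thesis
        using \<open>e > 0\<close> power2_less_imp_less[of "norm (p - q)" e] by (simp add: dist_norm p_def q_def)
    qed
    then show "\<exists>N. \<forall>n\<ge>N. \<forall>m\<ge>N. dist (x (s n)) (x (s m)) < e" by blast
  qed
  then show thesis using that s(1) by (auto simp: Cauchy_convergent_iff convergent_def)
qed


section \<open>The lattice operator on a set of sites\<close>

text \<open>Together with \<open>shift_ell2\<close> this builds coordinatewise majorants inside
  \<open>ell2\<close>; \<open>norm_ell2_mono\<close> then reduces an operator bound to the triangle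
  inequality for the majorant.\<close>

lift_definition abs_ell2 :: "ell2 \<Rightarrow> ell2" is "\<lambda>u i. \<bar>u i\<bar>"
  by (simp add: square_summable_def)

lift_definition shift_ell2 :: "int \<Rightarrow> ell2 \<Rightarrow> ell2" is "\<lambda>k u i. u (i + k)"
  by (rule square_summable_shift)

lemma norm_abs_ell2 [simp]: "norm (abs_ell2 u) = norm u"
  by (simp add: norm_ell2_def abs_ell2.rep_eq)

lemma norm_shift_ell2 [simp]: "norm (shift_ell2 k u) = norm u"
  unfolding norm_ell2_def shift_ell2.rep_eq
  using summable_shift(2)[OF summable_coord_square[of u], of k] by simp

lemma square_summable_restrict:
  assumes "square_summable u"
  shows "square_summable (\<lambda>i. if i \<in> S then u i else 0)"
  by (rule square_summable_comparison[OF assms[unfolded square_summable_def]]) auto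

text \<open>Dropping the differences outside \<open>S\<close> corresponds to restricting the row
  index \<open>k\<close> in the sum that defines \<open>Lapmat\<close>; this is why the last
  diagonal entry of that matrix is \<open>1\<close> and not \<open>2\<close>.\<close>

definition diff_on :: "int set \<Rightarrow> (int \<Rightarrow> real) \<Rightarrow> int \<Rightarrow> real" where
  "diff_on S u i = (if i \<in> S then Dminus u i else 0)"

lift_definition grad_on :: "int set \<Rightarrow> ell2 \<Rightarrow> ell2" is diff_on
  unfolding diff_on_def by (intro square_summable_restrict square_summable_Dminus)

text \<open>With \<open>S = UNIV\<close> this is \<open>F\<close>; with \<open>S = {- m..m}\<close> it agrees with \<open>Ftrunc m\<close> on \<open>vecs m\<close>,
  because the matrix \<open>Lapmat m\<close> is the product of the transpose of \<open>Dmat\<close> with \<open>Dmat\<close>.\<close>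

lift_definition lattice_op ::
  "int set \<Rightarrow> real \<Rightarrow> real \<Rightarrow> real \<Rightarrow> real \<Rightarrow> real \<Rightarrow> ell2 \<Rightarrow> ell2 \<Rightarrow> ell2" is
  "\<lambda>S \<alpha> \<beta> \<nu> \<gamma> lam f u i.
     if i \<in> S then
       \<nu> * (diff_on S u (i + 1) - diff_on S u i) - \<alpha> * (u i * Dminus u i)
         + \<beta> * (u i * (1 - u i) * (u i - \<gamma>)) - lam * u i + f i
     else 0"
proof (rule square_summable_restrict)
  fix S :: "int set" and \<alpha> \<beta> \<nu> \<gamma> lam :: real and f u :: "int \<Rightarrow> real"
  assume fu: "square_summable f" "square_summable u"
  then have d: "square_summable (diff_on S u)"
    unfolding diff_on_def by (intro square_summable_restrict square_summable_Dminus)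
  show "square_summable (\<lambda>i. \<nu> * (diff_on S u (i + 1) - diff_on S u i) - \<alpha> * (u i * Dminus u i)
         + \<beta> * (u i * (1 - u i) * (u i - \<gamma>)) - lam * u i + f i)"
    by (intro square_summable_add square_summable_diff square_summable_scale
        square_summable_shift[OF d] square_summable_mult square_summable_Dminus
        square_summable_cubic d fu)
qed

lemma lattice_op_UNIV: "lattice_op UNIV \<alpha> \<beta> \<nu> \<gamma> lam f u = F \<alpha> \<beta> \<nu> \<gamma> lam f u"
  by (rule ell2_eqI) (simp add: lattice_op.rep_eq F.rep_eq diff_on_def Lap_def Dminus_def)

text \<open>Only the end sites need care: at \<open>- m\<close> the bi-infinite difference reads
  \<open>z (- m - 1) = 0\<close>, and at \<open>m\<close> the difference towards
  \<open>m + 1\<close> is removed by \<open>diff_on\<close>.\<close>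

lemma lattice_op_interval:
  assumes "z \<in> vecs m"
  shows "lattice_op {- int m..int m} \<alpha> \<beta> \<nu> \<gamma> lam (trunc m f) z = Ftrunc m \<alpha> \<beta> \<nu> \<gamma> lam f z"
proof (rule ell2_eqI)
  fix i
  define z' where "z' = coord z"
  have z0: "z' j = 0" if "j \<notin> {- int m..int m}" for j
    using assms that by (auto simp: vecs_def z'_def)
  have sum_single: "(\<Sum>j = - int m..int m. if j = k then c else 0) = (if k \<in> {- int m..int m} then c else 0)"
    for k and c :: real by simp
  show "coord (lattice_op {- int m..int m} \<alpha> \<beta> \<nu> \<gamma> lam (trunc m f) z) i
      = coord (Ftrunc m \<alpha> \<beta> \<nu> \<gamma> lam f z) i"
  proof (cases "\<bar>i\<bar> \<le> int m")
    case True
    then have iS: "i \<in> {- int m..int m}" by auto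
    have "mat_vec m Dmat z' i = (\<Sum>j = - int m..int m.
        (if j = i then - z' i else 0) + (if j = i - 1 then z' (i - 1) else 0))"
      unfolding mat_vec_def by (rule sum.cong) (auto simp: Dmat_def)
    also have "\<dots> = Dminus z' i"
      using iS z0[of "i - 1"] unfolding sum.distrib sum_single by (auto simp: Dminus_def)
    finally have D: "mat_vec m Dmat z' i = Dminus z' i" .
    have "mat_vec m (Lapmat m) z' i = (\<Sum>j = - int m..int m.
        ((if j = i then (if i = int m then 1 else 2) * z' i else 0)
          + (if j = i - 1 then - z' (i - 1) else 0)) + (if j = i + 1 then - z' (i + 1) else 0))"
      unfolding mat_vec_def
      by (rule sum.cong) (use True in \<open>auto simp: Lapmat_tridiagonal\<close>)
    also have "\<dots> = diff_on {- int m..int m} z' (i + 1) - diff_on {- int m..int m} z' i"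
      using iS z0[of "i - 1"] z0[of "i + 1"]
      unfolding sum.distrib sum_single by (auto simp: diff_on_def Dminus_def)
    finally show ?thesis
      using True iS D by (simp add: lattice_op.rep_eq Ftrunc.rep_eq trunc.rep_eq z'_def)
  next
    case False
    then show ?thesis by (auto simp: lattice_op.rep_eq Ftrunc.rep_eq)
  qed
qed

section \<open>Growth and Lipschitz bounds for the lattice operator\<close>

lemma abs_sum4_le:
  fixes a b c d :: real
  assumes "\<bar>a\<bar> \<le> A" "\<bar>b\<bar> \<le> B" "\<bar>c\<bar> \<le> C" "\<bar>d\<bar> \<le> D"
  shows "\<bar>a - b + c + d\<bar> \<le> A + B + C + D"
  using assms by linarith

lemma norm_scaleR_le: "0 \<le> a \<Longrightarrow> norm x \<le> b \<Longrightarrow> norm (a *\<^sub>R x) \<le> a * b"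
  by (simp add: mult_left_mono)

lemma norm_grad_on: "norm (grad_on S u) \<le> 2 * norm u"
proof -
  have "norm (grad_on S u) \<le> norm (abs_ell2 (shift_ell2 (- 1) u) + abs_ell2 u)"
    by (rule norm_ell2_mono)
      (auto simp: grad_on.rep_eq diff_on_def Dminus_def abs_ell2.rep_eq shift_ell2.rep_eq)
  also have "\<dots> \<le> 2 * norm u"
    using norm_triangle_ineq[of "abs_ell2 (shift_ell2 (- 1) u)" "abs_ell2 u"] by simp
  finally show ?thesis .
qed

lemma grad_on_diff: "grad_on S u - grad_on S v = grad_on S (u - v)"
  by (rule ell2_eqI) (simp add: grad_on.rep_eq diff_on_def Dminus_def)

text \<open>A coordinate never exceeds the norm, so in each nonlinear term all factors but one are
  bounded through \<open>R\<close>, and the last one stays in \<open>ell2\<close>. \<open>Z\<close>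
  collects these majorants.\<close>

lemma lattice_op_growth:
  assumes "0 \<le> \<alpha>" "0 \<le> \<beta>" "0 \<le> \<nu>" "0 \<le> \<gamma>" "0 \<le> lam" and u: "norm u \<le> R"
  shows "norm (lattice_op S \<alpha> \<beta> \<nu> \<gamma> lam f u) \<le> M_const \<alpha> \<beta> \<nu> \<gamma> lam f R"
proof -
  define w where "w = grad_on S u"
  define c where "c = \<beta> * (R\<^sup>2 + (1 + \<gamma>) * R + \<gamma>) + lam"
  define Z where "Z = \<nu> *\<^sub>R (abs_ell2 (shift_ell2 1 w) + abs_ell2 w)
    + (\<alpha> * R) *\<^sub>R (abs_ell2 (shift_ell2 (- 1) u) + abs_ell2 u) + c *\<^sub>R abs_ell2 u + abs_ell2 f"
  have R0: "0 \<le> R" using u norm_ge_zero order_trans by blast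
  have c0: "0 \<le> c" using assms R0 by (simp add: c_def)
  have "norm (lattice_op S \<alpha> \<beta> \<nu> \<gamma> lam f u) \<le> norm Z"
  proof (rule norm_ell2_mono)
    fix i
    define x y where "x = coord u (i - 1)" and "y = coord u i"
    have y: "\<bar>y\<bar> \<le> R" using abs_coord_le_norm[of u i] u by (simp add: y_def)
    have t1: "\<bar>\<nu> * (coord w (i + 1) - coord w i)\<bar> \<le> \<nu> * (\<bar>coord w (i + 1)\<bar> + \<bar>coord w i\<bar>)"
      using assms(3) abs_triangle_ineq4[of "coord w (i + 1)" "coord w i"]
      by (simp add: abs_mult mult_left_mono)
    have t2: "\<bar>\<alpha> * (y * (x - y))\<bar> \<le> \<alpha> * R * (\<bar>x\<bar> + \<bar>y\<bar>)"
      unfolding abs_mult mult.assoc using assms(1) y R0 abs_triangle_ineq4[of x y]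
      by (intro mult_mono) auto
    have "\<bar>(1 - y) * (y - \<gamma>)\<bar> = \<bar>- y\<^sup>2 + (1 + \<gamma>) * y - \<gamma>\<bar>"
      by (rule arg_cong[where f = abs]) (simp add: power2_eq_square algebra_simps)
    also have "\<dots> \<le> \<bar>y\<bar>\<^sup>2 + (1 + \<gamma>) * \<bar>y\<bar> + \<gamma>"
    proof -
      have "\<bar>(1 + \<gamma>) * y\<bar> = (1 + \<gamma>) * \<bar>y\<bar>" using assms(4) by (simp add: abs_mult)
      then show ?thesis using assms(4) zero_le_power2[of y] unfolding power2_abs by linarith
    qed
    also have "\<dots> \<le> R\<^sup>2 + (1 + \<gamma>) * R + \<gamma>"
      using y assms(4) by (intro add_mono mult_left_mono power_mono) auto
    finally have "\<bar>\<beta> * ((1 - y) * (y - \<gamma>)) * y\<bar> \<le> \<beta> * (R\<^sup>2 + (1 + \<gamma>) * R + \<gamma>) * \<bar>y\<bar>"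
      using assms(2) by (simp add: abs_mult mult_left_mono mult_right_mono)
    moreover have "\<bar>lam * y\<bar> = lam * \<bar>y\<bar>" using assms(5) by (simp add: abs_mult)
    ultimately have t3: "\<bar>\<beta> * (y * (1 - y) * (y - \<gamma>)) - lam * y\<bar> \<le> c * \<bar>y\<bar>"
      unfolding c_def distrib_right
      using abs_triangle_ineq4[of "\<beta> * ((1 - y) * (y - \<gamma>)) * y" "lam * y"] by (simp add: mult_ac)
    have Z: "coord Z i = \<nu> * (\<bar>coord w (i + 1)\<bar> + \<bar>coord w i\<bar>) + \<alpha> * R * (\<bar>x\<bar> + \<bar>y\<bar>)
        + c * \<bar>y\<bar> + \<bar>coord f i\<bar>"
      by (simp add: Z_def abs_ell2.rep_eq shift_ell2.rep_eq x_def y_def)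
    have "coord (lattice_op S \<alpha> \<beta> \<nu> \<gamma> lam f u) i = (if i \<in> S then
        \<nu> * (coord w (i + 1) - coord w i) - \<alpha> * (y * (x - y))
        + (\<beta> * (y * (1 - y) * (y - \<gamma>)) - lam * y) + coord f i else 0)"
      by (simp add: lattice_op.rep_eq w_def grad_on.rep_eq Dminus_def x_def y_def)
    moreover have "0 \<le> coord Z i"
      unfolding Z using assms R0 c0 by (intro add_nonneg_nonneg mult_nonneg_nonneg) auto
    ultimately show "\<bar>coord (lattice_op S \<alpha> \<beta> \<nu> \<gamma> lam f u) i\<bar> \<le> coord Z i"
      using abs_sum4_le[OF t1 t2 t3 order_refl] unfolding Z by simp
  qed
  also have "norm Z \<le> \<nu> * (norm w + norm w) + \<alpha> * R * (norm u + norm u) + c * norm u + norm f"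
    unfolding Z_def using assms(1,3) R0 c0
    by (intro norm_triangle_mono norm_scaleR_le) simp_all
  also have "\<dots> \<le> \<nu> * (2 * R + 2 * R) + \<alpha> * R * (R + R) + c * R + norm f"
    using norm_grad_on[of S u] u assms R0 c0 unfolding w_def
    by (intro add_mono mult_left_mono) auto
  also have "\<dots> = M_const \<alpha> \<beta> \<nu> \<gamma> lam f R"
    by (simp add: M_const_def c_def power2_eq_square power3_eq_cube algebra_simps)
  finally show ?thesis .
qed

text \<open>The majorant method gives the constant
  \<open>4 * \<nu> + 4 * R * \<alpha> + p * \<beta> + lam\<close>; the square roots of
  \<open>L_const\<close> appear only in a final comparison.\<close>

lemma lattice_op_lipschitz:
  assumes "0 \<le> \<alpha>" "0 \<le> \<beta>" "0 \<le> \<nu>" "0 \<le> \<gamma>" "0 \<le> lam" and u: "norm u \<le> R" and v: "norm v \<le> R"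
  shows "norm (lattice_op S \<alpha> \<beta> \<nu> \<gamma> lam f u - lattice_op S \<alpha> \<beta> \<nu> \<gamma> lam f v)
    \<le> L_const \<alpha> \<beta> \<nu> \<gamma> lam R * norm (u - v)"
proof -
  define d where "d = u - v"
  define w where "w = grad_on S d"
  \<comment> \<open>Bounds the derivative
    \<open>- 3 * y ^ 2 + 2 * (1 + \<gamma>) * y - \<gamma>\<close> of the cubic for
    \<open>\<bar>y\<bar> \<le> R\<close>, and likewise its difference quotients.\<close>
  define p where "p = 3 * R\<^sup>2 + 2 * (1 + \<gamma>) * R + \<gamma>"
  define c where "c = 3 * R * \<alpha> + \<beta> * p + lam"
  define Z where "Z = \<nu> *\<^sub>R (abs_ell2 (shift_ell2 1 w) + abs_ell2 w)
    + (\<alpha> * R) *\<^sub>R abs_ell2 (shift_ell2 (- 1) d) + c *\<^sub>R abs_ell2 d"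
  have R0: "0 \<le> R" using u norm_ge_zero order_trans by blast
  have p0: "0 \<le> p" using assms R0 by (simp add: p_def)
  then have c0: "0 \<le> c" using assms R0 by (simp add: c_def)
  have "norm (lattice_op S \<alpha> \<beta> \<nu> \<gamma> lam f u - lattice_op S \<alpha> \<beta> \<nu> \<gamma> lam f v) \<le> norm Z"
  proof (rule norm_ell2_mono)
    fix i
    define x y x' y' where "x = coord u (i - 1)" and "y = coord u i"
      and "x' = coord v (i - 1)" and "y' = coord v i"
    have bd: "\<bar>x\<bar> \<le> R" "\<bar>y\<bar> \<le> R" "\<bar>y'\<bar> \<le> R"
      using order_trans[OF abs_coord_le_norm u] order_trans[OF abs_coord_le_norm v]
      by (auto simp: x_def y_def y'_def)
    have t1: "\<bar>\<nu> * (coord w (i + 1) - coord w i)\<bar> \<le> \<nu> * (\<bar>coord w (i + 1)\<bar> + \<bar>coord w i\<bar>)"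
      using assms(3) abs_triangle_ineq4[of "coord w (i + 1)" "coord w i"]
      by (simp add: abs_mult mult_left_mono)
    have t2: "\<bar>\<alpha> * (y * (x - y)) - \<alpha> * (y' * (x' - y'))\<bar>
        \<le> \<alpha> * R * \<bar>x - x'\<bar> + 3 * R * \<alpha> * \<bar>y - y'\<bar>"
    proof -
      have "\<alpha> * (y * (x - y)) - \<alpha> * (y' * (x' - y')) = \<alpha> * (y' * (x - x') + (x - y - y') * (y - y'))"
        by (simp add: algebra_simps)
      also have "\<bar>\<dots>\<bar> \<le> \<alpha> * (\<bar>y'\<bar> * \<bar>x - x'\<bar> + \<bar>x - y - y'\<bar> * \<bar>y - y'\<bar>)"
        unfolding abs_mult[symmetric] using assms(1)
        by (simp add: abs_mult[of \<alpha>] mult_left_mono)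
      also have "\<dots> \<le> \<alpha> * (R * \<bar>x - x'\<bar> + 3 * R * \<bar>y - y'\<bar>)"
        using bd assms(1) by (intro mult_left_mono add_mono mult_right_mono) auto
      finally show ?thesis by (simp add: algebra_simps)
    qed
    have t3: "\<bar>\<beta> * (y * (1 - y) * (y - \<gamma>)) - \<beta> * (y' * (1 - y') * (y' - \<gamma>))\<bar>
        \<le> \<beta> * p * \<bar>y - y'\<bar>"
    proof -
      have "\<bar>- (y\<^sup>2 + y * y' + y'\<^sup>2) + (1 + \<gamma>) * (y + y') - \<gamma>\<bar>
          \<le> (\<bar>y\<bar>\<^sup>2 + \<bar>y\<bar> * \<bar>y'\<bar> + \<bar>y'\<bar>\<^sup>2) + (1 + \<gamma>) * (\<bar>y\<bar> + \<bar>y'\<bar>) + \<gamma>"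
      proof -
        have "\<bar>(1 + \<gamma>) * (y + y')\<bar> \<le> (1 + \<gamma>) * (\<bar>y\<bar> + \<bar>y'\<bar>)"
          using assms(4) by (simp add: abs_mult mult_left_mono)
        then show ?thesis
          using assms(4) zero_le_power2[of y] zero_le_power2[of y'] abs_mult[of y y']
          unfolding power2_abs by linarith
      qed
      also have "\<dots> \<le> (R\<^sup>2 + R * R + R\<^sup>2) + (1 + \<gamma>) * (R + R) + \<gamma>"
        using bd assms(4) R0 by (intro add_mono mult_left_mono mult_mono power_mono) auto
      also have "\<dots> = p" by (simp add: p_def power2_eq_square algebra_simps)
      finally have "\<bar>\<beta> * (- (y\<^sup>2 + y * y' + y'\<^sup>2) + (1 + \<gamma>) * (y + y') - \<gamma>) * (y - y')\<bar>
          \<le> \<beta> * p * \<bar>y - y'\<bar>"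
        using assms(2) by (simp add: abs_mult mult_left_mono mult_right_mono)
      moreover have "\<beta> * (y * (1 - y) * (y - \<gamma>)) - \<beta> * (y' * (1 - y') * (y' - \<gamma>))
          = \<beta> * (- (y\<^sup>2 + y * y' + y'\<^sup>2) + (1 + \<gamma>) * (y + y') - \<gamma>) * (y - y')"
        by (simp add: power2_eq_square algebra_simps)
      ultimately show ?thesis by simp
    qed
    have t4: "\<bar>lam * y' - lam * y\<bar> \<le> lam * \<bar>y - y'\<bar>"
      using assms(5) by (simp add: abs_mult abs_minus_commute right_diff_distrib[symmetric])
    have Z: "coord Z i = \<nu> * (\<bar>coord w (i + 1)\<bar> + \<bar>coord w i\<bar>) + \<alpha> * R * \<bar>x - x'\<bar>
        + (3 * R * \<alpha> * \<bar>y - y'\<bar> + \<beta> * p * \<bar>y - y'\<bar> + lam * \<bar>y - y'\<bar>)"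
      by (simp add: Z_def c_def d_def abs_ell2.rep_eq shift_ell2.rep_eq x_def y_def x'_def y'_def
          distrib_right)
    have wi: "coord w j = coord (grad_on S u) j - coord (grad_on S v) j" for j
      by (simp add: w_def d_def grad_on_diff[symmetric])
    have "coord (lattice_op S \<alpha> \<beta> \<nu> \<gamma> lam f u - lattice_op S \<alpha> \<beta> \<nu> \<gamma> lam f v) i = (if i \<in> S then
        \<nu> * (coord w (i + 1) - coord w i) - (\<alpha> * (y * (x - y)) - \<alpha> * (y' * (x' - y')))
        + (\<beta> * (y * (1 - y) * (y - \<gamma>)) - \<beta> * (y' * (1 - y') * (y' - \<gamma>)))
        + (lam * y' - lam * y) else 0)"
      unfolding wi grad_on.rep_eq
      by (simp add: lattice_op.rep_eq Dminus_def x_def y_def x'_def y'_def algebra_simps)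
    moreover have "0 \<le> coord Z i"
      unfolding Z using assms R0 p0 by (intro add_nonneg_nonneg mult_nonneg_nonneg) auto
    ultimately show "\<bar>coord (lattice_op S \<alpha> \<beta> \<nu> \<gamma> lam f u - lattice_op S \<alpha> \<beta> \<nu> \<gamma> lam f v) i\<bar> \<le> coord Z i"
      using abs_sum4_le[OF t1 t2 t3 t4] unfolding Z by (simp add: add.assoc)
  qed
  also have "norm Z \<le> \<nu> * (norm w + norm w) + \<alpha> * R * norm d + c * norm d"
    unfolding Z_def using assms(1,3) R0 c0
    by (intro norm_triangle_mono norm_scaleR_le) simp_all
  also have "\<dots> \<le> \<nu> * (2 * norm d + 2 * norm d) + \<alpha> * R * norm d + c * norm d"
    using norm_grad_on[of S d] assms(1,3) R0 c0 unfolding w_def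
    by (intro add_mono mult_left_mono) auto
  also have "\<dots> = (4 * \<nu> + 2 * 2 * R * \<alpha> + p * \<beta> + lam) * norm d"
    by (simp add: c_def algebra_simps)
  also have "\<dots> \<le> L_const \<alpha> \<beta> \<nu> \<gamma> lam R * norm d"
  proof -
    have "2 \<le> sqrt (5 :: real)" by (rule real_le_rsqrt) simp
    moreover have "p \<le> sqrt (12 * R\<^sup>2 * (1 + \<gamma>)\<^sup>2 + 27 * R ^ 4 + 3 * \<gamma>\<^sup>2)"
    proof (rule real_le_rsqrt)
      \<comment> \<open>Cauchy-Schwarz for three terms; applied to the summands of \<open>p\<close>
        it produces the coefficients 12, 27 and 3 under the root.\<close>
      have cs: "(a + b + c)\<^sup>2 \<le> 3 * (a\<^sup>2 + b\<^sup>2 + c\<^sup>2)" for a b c :: real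
        using zero_le_power2[of "a - b"] zero_le_power2[of "b - c"] zero_le_power2[of "a - c"]
        by (simp add: power2_eq_square algebra_simps)
      have "(3 * R\<^sup>2)\<^sup>2 = 9 * R ^ 4" "(2 * (1 + \<gamma>) * R)\<^sup>2 = 4 * (R\<^sup>2 * (1 + \<gamma>)\<^sup>2)"
        by (simp add: power_mult_distrib) (simp add: power2_eq_square algebra_simps)
      then have "3 * ((3 * R\<^sup>2)\<^sup>2 + (2 * (1 + \<gamma>) * R)\<^sup>2 + \<gamma>\<^sup>2)
          = 12 * R\<^sup>2 * (1 + \<gamma>)\<^sup>2 + 27 * R ^ 4 + 3 * \<gamma>\<^sup>2" by simp
      then show "p\<^sup>2 \<le> 12 * R\<^sup>2 * (1 + \<gamma>)\<^sup>2 + 27 * R ^ 4 + 3 * \<gamma>\<^sup>2"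
        using cs[of "3 * R\<^sup>2" "2 * (1 + \<gamma>) * R" \<gamma>] by (simp only: p_def)
    qed
    ultimately show ?thesis
      unfolding L_const_def using assms R0
      by (intro mult_right_mono add_mono mult_left_mono) auto
  qed
  finally show ?thesis by (simp add: d_def)
qed


section \<open>Dissipativity\<close>

text \<open>Here \<open>a\<close>, \<open>b\<close> are the weights and \<open>x\<close>,
  \<open>y\<close> the values at sites \<open>i - 1\<close>, \<open>i\<close>, while
  \<open>w\<close>, \<open>w'\<close> are the differences at \<open>i\<close>, \<open>i + 1\<close>.
  The bracket after the force term is a quantity at \<open>i\<close> minus the same quantity at
  \<open>i - 1\<close>. Moving a term between the two sites exchanges \<open>a\<close> and
  \<open>b\<close>, which costs a multiple of \<delta>.\<close>

lemma sitewise_dissipation: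
  fixes a b x y w w' f \<alpha> \<beta> \<nu> \<gamma> lam \<kappa> :: real
  assumes pos: "0 < \<alpha>" "0 < \<beta>" "0 < \<nu>" "0 < \<gamma>" "0 < \<kappa>"
    and \<kappa>: "\<kappa> = lam - lambda_star \<alpha> \<beta> \<nu> \<gamma>"
    and ab: "0 \<le> a" "0 \<le> b" "\<bar>b - a\<bar> \<le> \<delta>" and x: "\<bar>x\<bar> \<le> R" and w: "\<bar>w\<bar> \<le> \<bar>x\<bar> + \<bar>y\<bar>"
  shows "b * y * (\<nu> * (w' - w) - \<alpha> * (y * (x - y)) + \<beta> * (y * (1 - y) * (y - \<gamma>)) - lam * y + f)
    \<le> - (\<kappa> / 2) * (b * y\<^sup>2) + b * f\<^sup>2 / (2 * \<kappa>)
      + (\<nu> * (b * y * w' - a * x * w) + 2 * \<nu> * (a * x\<^sup>2 - b * y\<^sup>2) + \<alpha> / 3 * (a * \<bar>x\<bar> ^ 3 - b * \<bar>y\<bar> ^ 3))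
      + \<delta> * (\<nu> / 2 + \<alpha> * R / 3) * (x\<^sup>2 + y\<^sup>2)"
proof -
  define p q where "p = \<bar>y\<bar>" and "q = \<bar>x\<bar>"
  have pq: "0 \<le> p" "0 \<le> q" "p\<^sup>2 = y\<^sup>2" "q\<^sup>2 = x\<^sup>2" "q \<le> R" using x by (auto simp: p_def q_def)
  have \<delta>: "0 \<le> \<delta>" "b \<le> a + \<delta>" "a \<le> b + \<delta>" using ab(3) by auto
  have am: "p * q \<le> (p\<^sup>2 + q\<^sup>2) / 2"
    using zero_le_power2[of "p - q"] by (simp add: power2_eq_square algebra_simps)
  have ap: "a * p\<^sup>2 \<le> b * p\<^sup>2 + \<delta> * p\<^sup>2" and bq: "b * q\<^sup>2 \<le> a * q\<^sup>2 + \<delta> * q\<^sup>2"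
    using mult_right_mono[OF \<delta>(3), of "p\<^sup>2"] mult_right_mono[OF \<delta>(2), of "q\<^sup>2"]
    by (auto simp: distrib_right)
  \<comment> \<open>Summation by parts: \<open>b * y * (w' - w)\<close> is the telescoping
    difference \<open>b * y * w' - a * x * w\<close> plus this product.\<close>
  have "w * (a * x - b * y) \<le> (q + p) * (a * q + b * p)"
  proof -
    have "\<bar>a * x - b * y\<bar> \<le> a * q + b * p"
      using ab abs_triangle_ineq4[of "a * x" "b * y"] by (simp add: abs_mult p_def q_def)
    then have "\<bar>w\<bar> * \<bar>a * x - b * y\<bar> \<le> (q + p) * (a * q + b * p)"
      using w by (intro mult_mono) (auto simp: p_def q_def)
    then show ?thesis by (metis abs_ge_self abs_mult order_trans)
  qed
  also have "\<dots> = a * q\<^sup>2 + b * p\<^sup>2 + (a + b) * (p * q)" by (simp add: power2_eq_square algebra_simps)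
  also have "\<dots> \<le> a * q\<^sup>2 + b * p\<^sup>2 + (a + b) * ((p\<^sup>2 + q\<^sup>2) / 2)"
    using am ab by (intro add_left_mono mult_left_mono) auto
  also have "\<dots> \<le> 2 * a * q\<^sup>2 + 2 * b * p\<^sup>2 + \<delta> / 2 * (q\<^sup>2 + p\<^sup>2)"
    using ap bq by (simp add: algebra_simps add_divide_distrib)
  finally have "\<nu> * (w * (a * x - b * y)) \<le> \<nu> * (2 * a * q\<^sup>2 + 2 * b * p\<^sup>2 + \<delta> / 2 * (q\<^sup>2 + p\<^sup>2))"
    using pos by (intro mult_left_mono) auto
  \<comment> \<open>Writing \<open>2 * a * q ^ 2\<close> as a telescoping difference plus
    \<open>2 * b * p ^ 2\<close> doubles the local term; this is the \<open>4 * \<nu>\<close> of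
    \<open>lambda_star\<close>.\<close>
  then have diffusion: "b * y * (\<nu> * (w' - w)) \<le> \<nu> * (b * y * w' - a * x * w)
      + 2 * \<nu> * (a * x\<^sup>2 - b * y\<^sup>2) + 4 * \<nu> * (b * y\<^sup>2) + \<delta> * (\<nu> / 2) * (x\<^sup>2 + y\<^sup>2)"
    by (simp add: pq(3,4) algebra_simps)
  \<comment> \<open>Young's inequality leaves the neighbour only as a pure cube, which telescopes.
    The local cubes then add up to \<open>1 + 2 / 3 + 1 / 3 = 2\<close>, hence
    \<open>2 * \<alpha>\<close> in \<open>lambda_star\<close>.\<close>
  have "p\<^sup>2 * q \<le> 2 / 3 * p ^ 3 + 1 / 3 * q ^ 3"
  proof -
    have "0 \<le> (p - q)\<^sup>2 * (2 * p + q)" using pq by simp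
    then show ?thesis by (simp add: power2_eq_square power3_eq_cube algebra_simps)
  qed
  then have "b * (p\<^sup>2 * q) \<le> b * (2 / 3 * p ^ 3 + 1 / 3 * q ^ 3)"
    using ab by (intro mult_left_mono)
  moreover have "b * q ^ 3 \<le> a * q ^ 3 + \<delta> * (R * q\<^sup>2)"
  proof -
    have "b * q ^ 3 \<le> (a + \<delta>) * q ^ 3" using \<delta> pq by (intro mult_right_mono) auto
    moreover have "\<delta> * q ^ 3 \<le> \<delta> * (R * q\<^sup>2)"
    proof (rule mult_left_mono)
      have "q ^ 3 = q * q\<^sup>2" by (simp add: power3_eq_cube power2_eq_square)
      also have "\<dots> \<le> R * q\<^sup>2" using pq(5) by (intro mult_right_mono) auto
      finally show "q ^ 3 \<le> R * q\<^sup>2" .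
    qed (use \<delta> in simp)
    ultimately show ?thesis by (simp add: distrib_right)
  qed
  moreover have "- (b * (y\<^sup>2 * (x - y))) \<le> b * (p\<^sup>2 * q) + b * p ^ 3"
  proof -
    have "y\<^sup>2 * (y - x) \<le> y\<^sup>2 * (q + p)"
      by (intro mult_left_mono) (auto simp: p_def q_def)
    then have "b * (y\<^sup>2 * (y - x)) \<le> b * (y\<^sup>2 * (q + p))"
      using ab(2) by (rule mult_left_mono)
    then show ?thesis unfolding pq(3)[symmetric]
      by (simp add: power2_eq_square power3_eq_cube algebra_simps)
  qed
  moreover have "\<delta> * (R * q\<^sup>2) \<le> \<delta> * R * (q\<^sup>2 + p\<^sup>2)"
  proof -
    have "0 \<le> \<delta> * R * p\<^sup>2" using \<delta> pq by (intro mult_nonneg_nonneg) auto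
    then show ?thesis by (simp add: algebra_simps)
  qed
  ultimately have "- (b * (y\<^sup>2 * (x - y)))
      \<le> 2 * (b * p ^ 3) + 1 / 3 * (a * q ^ 3 - b * p ^ 3) + 1 / 3 * (\<delta> * R * (q\<^sup>2 + p\<^sup>2))"
    by (simp add: algebra_simps)
  then have *: "\<alpha> * (- (b * (y\<^sup>2 * (x - y))))
      \<le> \<alpha> * (2 * (b * p ^ 3) + 1 / 3 * (a * q ^ 3 - b * p ^ 3) + 1 / 3 * (\<delta> * R * (q\<^sup>2 + p\<^sup>2)))"
    using pos by (intro mult_left_mono) auto
  have convection: "- (b * y * (\<alpha> * (y * (x - y)))) \<le> 2 * \<alpha> * (b * p ^ 3)
      + \<alpha> / 3 * (a * \<bar>x\<bar> ^ 3 - b * \<bar>y\<bar> ^ 3) + \<delta> * (\<alpha> * R / 3) * (x\<^sup>2 + y\<^sup>2)"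
  proof -
    have "- (b * y * (\<alpha> * (y * (x - y)))) = \<alpha> * (- (b * (y\<^sup>2 * (x - y))))"
      by (simp add: power2_eq_square)
    then show ?thesis
      using * unfolding pq(3,4) p_def[symmetric] q_def[symmetric] by (simp add: algebra_simps add_divide_distrib)
  qed
  \<comment> \<open>Completing the square in \<open>c * p - \<beta> * p ^ 2\<close> gives the
    quotient in \<open>lambda_star\<close>.\<close>
  define c where "c = 2 * \<alpha> + \<beta> + \<beta> * \<gamma>"
  have "c * p - \<beta> * p\<^sup>2 \<le> c\<^sup>2 / (4 * \<beta>)"
  proof -
    have "0 \<le> (c - 2 * \<beta> * p)\<^sup>2 / (4 * \<beta>)" using pos by simp
    also have "\<dots> = c\<^sup>2 / (4 * \<beta>) - (c * p - \<beta> * p\<^sup>2)"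
      using pos by (simp add: power2_eq_square field_simps)
    finally show ?thesis by simp
  qed
  moreover have "2 * \<alpha> * p + \<beta> * ((1 - y) * (y - \<gamma>)) \<le> c * p - \<beta> * p\<^sup>2 - \<beta> * \<gamma>"
  proof -
    have "\<beta> * (1 + \<gamma>) * y \<le> \<beta> * (1 + \<gamma>) * p"
      using pos by (intro mult_left_mono) (auto simp: p_def)
    then show ?thesis unfolding c_def pq(3) by (simp add: power2_eq_square algebra_simps)
  qed
  ultimately have "2 * \<alpha> * p + \<beta> * ((1 - y) * (y - \<gamma>)) \<le> lam - \<kappa> - 4 * \<nu>"
    by (simp add: \<kappa> lambda_star_def c_def)
  then have "b * y\<^sup>2 * (2 * \<alpha> * p + \<beta> * ((1 - y) * (y - \<gamma>))) \<le> b * y\<^sup>2 * (lam - \<kappa> - 4 * \<nu>)"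
    using ab by (intro mult_left_mono) auto
  then have reaction: "2 * \<alpha> * (b * p ^ 3) + b * y * (\<beta> * (y * (1 - y) * (y - \<gamma>)))
      \<le> lam * (b * y\<^sup>2) - \<kappa> * (b * y\<^sup>2) - 4 * \<nu> * (b * y\<^sup>2)"
    unfolding pq(3)[symmetric] power3_eq_cube
    by (simp add: power2_eq_square p_def algebra_simps)
  \<comment> \<open>Young's inequality tuned to spend half of the rate \<kappa>, leaving
    \<open>\<kappa> / 2\<close> for the decay.\<close>
  have "y * f \<le> \<kappa> / 2 * y\<^sup>2 + f\<^sup>2 / (2 * \<kappa>)"
  proof -
    have "0 \<le> (\<kappa> * y - f)\<^sup>2 / (2 * \<kappa>)" using pos by simp
    also have "\<dots> = \<kappa> / 2 * y\<^sup>2 + f\<^sup>2 / (2 * \<kappa>) - y * f"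
      using pos by (simp add: power2_eq_square field_simps)
    finally show ?thesis by simp
  qed
  then have "b * (y * f) \<le> b * (\<kappa> / 2 * y\<^sup>2 + f\<^sup>2 / (2 * \<kappa>))" using ab by (intro mult_left_mono)
  then have forcing: "b * y * f \<le> \<kappa> / 2 * (b * y\<^sup>2) + b * f\<^sup>2 / (2 * \<kappa>)"
    by (simp add: algebra_simps)
  have "b * y * (\<nu> * (w' - w) - \<alpha> * (y * (x - y)) + \<beta> * (y * (1 - y) * (y - \<gamma>)) - lam * y + f)
      = b * y * (\<nu> * (w' - w)) - b * y * (\<alpha> * (y * (x - y)))
        + b * y * (\<beta> * (y * (1 - y) * (y - \<gamma>))) - lam * (b * y\<^sup>2) + b * y * f"
    by (simp add: power2_eq_square algebra_simps)
  moreover have "\<delta> * (\<nu> / 2 + \<alpha> * R / 3) * (x\<^sup>2 + y\<^sup>2)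
      = \<delta> * (\<nu> / 2) * (x\<^sup>2 + y\<^sup>2) + \<delta> * (\<alpha> * R / 3) * (x\<^sup>2 + y\<^sup>2)"
    by (simp add: algebra_simps)
  moreover have "- (\<kappa> / 2) * (b * y\<^sup>2) = \<kappa> / 2 * (b * y\<^sup>2) - \<kappa> * (b * y\<^sup>2)" by simp
  ultimately show ?thesis using diffusion convection reaction forcing by linarith
qed

section \<open>The energy inequality for one implicit step\<close>

locale dissipative_lattice =
  fixes \<alpha> \<beta> \<nu> \<gamma> lam :: real
  assumes pos: "0 < \<alpha>" "0 < \<beta>" "0 < \<nu>" "0 < \<gamma>" "\<gamma> < 1"
    and lam: "lambda_star \<alpha> \<beta> \<nu> \<gamma> < lam"
begin

definition \<kappa> :: real where "\<kappa> = lam - lambda_star \<alpha> \<beta> \<nu> \<gamma>"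

abbreviation G :: "int set \<Rightarrow> ell2 \<Rightarrow> ell2 \<Rightarrow> ell2" where
  "G S \<equiv> lattice_op S \<alpha> \<beta> \<nu> \<gamma> lam"

lemma \<kappa>_pos: "0 < \<kappa>"
  using lam by (simp add: \<kappa>_def)

text \<open>Dropping \<alpha> and \<nu> from \<open>lambda_star\<close> leaves
  \<open>\<beta> * (1 - \<gamma>) ^ 2 / 4\<close>, which is nonnegative. The growth and Lipschitz
  bounds require this sign of \<open>lam\<close>.\<close>

lemma lam_pos: "0 < lam"
proof -
  have "(\<beta> * (1 + \<gamma>))\<^sup>2 \<le> (2 * \<alpha> + \<beta> + \<beta> * \<gamma>)\<^sup>2"
    using pos by (intro power_mono) (auto simp: algebra_simps)
  then have "(\<beta> * (1 + \<gamma>))\<^sup>2 / (4 * \<beta>) \<le> (2 * \<alpha> + \<beta> + \<beta> * \<gamma>)\<^sup>2 / (4 * \<beta>)"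
    using pos by (intro divide_right_mono) auto
  moreover have "(\<beta> * (1 + \<gamma>))\<^sup>2 / (4 * \<beta>) - \<beta> * \<gamma> = \<beta> * (1 - \<gamma>)\<^sup>2 / 4"
    using pos by (simp add: power2_eq_square field_simps)
  moreover have "0 \<le> \<beta> * (1 - \<gamma>)\<^sup>2 / 4" using pos by simp
  ultimately have "0 \<le> lambda_star \<alpha> \<beta> \<nu> \<gamma>" unfolding lambda_star_def using pos by linarith
  then show ?thesis using lam by linarith
qed

text \<open>Multiply the scheme sitewise by \<open>\<theta> i * u i\<close> and sum: the discrete derivatives telescope up
  to an error proportional to \<open>\<delta>\<close>.\<close>

lemma energy_step:
  assumes u: "u = v + \<epsilon> *\<^sub>R G S f u" and S: "u \<in> ell2_on S" and R: "norm u \<le> R"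
    and \<epsilon>: "0 < \<epsilon>" and \<theta>: "slow_weight \<delta> \<theta>"
  shows "(1 + \<epsilon> * \<kappa>) * wsum \<theta> u
    \<le> wsum \<theta> v + \<epsilon> * (wsum \<theta> f / \<kappa> + \<delta> * (2 * \<nu> + 4 * \<alpha> * R / 3) * R\<^sup>2)"
proof -
  define y where "y = coord u"
  define w where "w = diff_on S y"
  define C where "C = \<nu> / 2 + \<alpha> * R / 3"
  \<comment> \<open>The flux whose increment from \<open>i - 1\<close> to \<open>i\<close> is the
    bracket in \<open>sitewise_dissipation\<close>. It must be summable, so that it and its shift
    have equal sums and cancel.\<close>
  define Q where "Q i = \<nu> * (\<theta> i * y i * w (i + 1)) - 2 * \<nu> * (\<theta> i * (y i)\<^sup>2)
    - \<alpha> / 3 * (\<theta> i * \<bar>y i\<bar> ^ 3)" for i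
  have th: "0 \<le> \<theta> i" "\<theta> i \<le> 1" "\<bar>\<theta> i - \<theta> (i - 1)\<bar> \<le> \<delta>" for i
    using \<theta> by (auto simp: slow_weight_def)
  have \<delta>0: "0 \<le> \<delta>" using th(3)[of 0] by linarith
  have yR: "\<bar>y i\<bar> \<le> R" for i
    using order_trans[OF abs_coord_le_norm R] by (simp add: y_def)
  then have R0: "0 \<le> R" using abs_ge_zero order_trans by blast
  have C0: "0 \<le> C" using pos R0 by (simp add: C_def)
  have y2: "(\<lambda>i. (y i)\<^sup>2) summable_on UNIV" by (simp add: y_def)
  have y2': "(\<lambda>i. (y (i - 1))\<^sup>2) summable_on UNIV" "(\<Sum>\<^sub>\<infinity>i. (y (i - 1))\<^sup>2) = (\<Sum>\<^sub>\<infinity>i. (y i)\<^sup>2)"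
    using summable_shift[OF y2, of "- 1"] by auto
  have Qs: "Q summable_on UNIV"
  proof -
    have "(\<lambda>i. \<theta> i * y i * w (i + 1)) summable_on UNIV"
    proof (rule product_summable)
      show "square_summable (\<lambda>i. \<theta> i * y i)"
        by (rule square_summable_comparison[OF y2])
          (use th in \<open>auto simp: power_mult_distrib power_le_one mult_left_le_one_le\<close>)
      show "square_summable (\<lambda>i. w (i + 1))"
        using square_summable_shift[OF square_summable_coord[of "grad_on S u"], of 1]
        by (simp add: grad_on.rep_eq w_def y_def)
    qed
    moreover have "(\<lambda>i. \<theta> i * (y i)\<^sup>2) summable_on UNIV"
      using wsum_summable[OF \<theta>] by (simp add: y_def)
    moreover have "(\<lambda>i. \<theta> i * \<bar>y i\<bar> ^ 3) summable_on UNIV"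
    proof (rule summable_on_comparison_test)
      show "(\<lambda>i. R * (y i)\<^sup>2) summable_on UNIV" by (intro summable_on_cmult_right y2)
      fix i
      show "0 \<le> \<theta> i * \<bar>y i\<bar> ^ 3" using th by simp
      have "\<theta> i * \<bar>y i\<bar> ^ 3 \<le> 1 * \<bar>y i\<bar> ^ 3" using th by (intro mult_right_mono) auto
      also have "\<dots> = \<bar>y i\<bar> * (y i)\<^sup>2" by (simp add: power3_eq_cube power2_eq_square)
      also have "\<dots> \<le> R * (y i)\<^sup>2" using yR by (intro mult_right_mono) auto
      finally show "\<theta> i * \<bar>y i\<bar> ^ 3 \<le> R * (y i)\<^sup>2" .
    qed
    ultimately show ?thesis
      unfolding Q_def diff_conv_add_uminus
      by (intro summable_on_add summable_on_uminus[THEN iffD2] summable_on_cmult_right)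
  qed
  have Qs': "(\<lambda>i. Q (i - 1)) summable_on UNIV" "(\<Sum>\<^sub>\<infinity>i. Q (i - 1)) = (\<Sum>\<^sub>\<infinity>i. Q i)"
    using summable_shift[OF Qs, of "- 1"] by auto
  have site: "(1 + \<epsilon> * \<kappa>) * (\<theta> i * (y i)\<^sup>2) + 2 * \<epsilon> * Q (i - 1)
      \<le> \<theta> i * (coord v i)\<^sup>2 + \<epsilon> / \<kappa> * (\<theta> i * (coord f i)\<^sup>2) + 2 * \<epsilon> * Q i
        + (2 * \<epsilon> * (\<delta> * C)) * ((y (i - 1))\<^sup>2 + (y i)\<^sup>2)" for i
  proof -
    let ?g = "\<nu> * (w (i + 1) - w i) - \<alpha> * (y i * (y (i - 1) - y i))
      + \<beta> * (y i * (1 - y i) * (y i - \<gamma>)) - lam * y i + coord f i"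
    \<comment> \<open>Off \<open>S\<close> the operator is \<open>0\<close> and differs from
      \<open>?g\<close>, but the test value \<open>y i\<close> vanishes there.\<close>
    have g: "y i * coord (G S f u) i = y i * ?g"
    proof (cases "i \<in> S")
      case False
      then have "y i = 0" using S by (simp add: ell2_on_def y_def)
      then show ?thesis by simp
    qed (simp add: lattice_op.rep_eq w_def y_def Dminus_def)
    have "\<bar>w i\<bar> \<le> \<bar>y (i - 1)\<bar> + \<bar>y i\<bar>"
      using abs_triangle_ineq4[of "y (i - 1)" "y i"] by (simp add: w_def diff_on_def Dminus_def)
    then have "\<theta> i * y i * ?g \<le> - (\<kappa> / 2) * (\<theta> i * (y i)\<^sup>2) + \<theta> i * (coord f i)\<^sup>2 / (2 * \<kappa>)
      + (\<nu> * (\<theta> i * y i * w (i + 1) - \<theta> (i - 1) * y (i - 1) * w i)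
        + 2 * \<nu> * (\<theta> (i - 1) * (y (i - 1))\<^sup>2 - \<theta> i * (y i)\<^sup>2)
        + \<alpha> / 3 * (\<theta> (i - 1) * \<bar>y (i - 1)\<bar> ^ 3 - \<theta> i * \<bar>y i\<bar> ^ 3))
      + \<delta> * (\<nu> / 2 + \<alpha> * R / 3) * ((y (i - 1))\<^sup>2 + (y i)\<^sup>2)"
      using pos \<kappa>_pos th yR by (intro sitewise_dissipation) (auto simp: \<kappa>_def)
    also have "\<dots> = - (\<kappa> / 2) * (\<theta> i * (y i)\<^sup>2) + \<theta> i * (coord f i)\<^sup>2 / (2 * \<kappa>)
      + (Q i - Q (i - 1)) + \<delta> * C * ((y (i - 1))\<^sup>2 + (y i)\<^sup>2)"
      by (simp add: Q_def C_def right_diff_distrib)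
    finally have d: "\<theta> i * (y i * ?g) \<le> \<dots>" by (simp only: mult.assoc)
    have "y i = coord v i + \<epsilon> * coord (G S f u) i"
      unfolding y_def by (subst u) simp
    then have "\<theta> i * (y i * y i) = \<theta> i * (y i * coord v i) + \<epsilon> * (\<theta> i * (y i * ?g))"
      unfolding g[symmetric] by (metis (no_types, opaque_lifting) distrib_left mult.left_commute)
    \<comment> \<open>Half of \<open>y i ^ 2\<close> is absorbed on the left; doubling the remainder
      turns \<open>\<kappa> / 2\<close> into the rate \<kappa>.\<close>
    moreover have "\<theta> i * (y i * coord v i) \<le> \<theta> i * (((y i)\<^sup>2 + (coord v i)\<^sup>2) / 2)"
      using th zero_le_power2[of "y i - coord v i"]
      by (intro mult_left_mono) (auto simp: power2_eq_square algebra_simps)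
    moreover note mult_left_mono[OF d less_imp_le[OF \<epsilon>]]
    ultimately have e: "\<theta> i * (y i)\<^sup>2 \<le> \<theta> i * (((y i)\<^sup>2 + (coord v i)\<^sup>2) / 2)
      + \<epsilon> * (- (\<kappa> / 2) * (\<theta> i * (y i)\<^sup>2) + \<theta> i * (coord f i)\<^sup>2 / (2 * \<kappa>)
      + (Q i - Q (i - 1)) + \<delta> * C * ((y (i - 1))\<^sup>2 + (y i)\<^sup>2))"
      unfolding power2_eq_square[of "y i"] by linarith
    define N V P E where "N = \<theta> i * (y i)\<^sup>2" and "V = \<theta> i * (coord v i)\<^sup>2"
      and "P = \<theta> i * (coord f i)\<^sup>2" and "E = (y (i - 1))\<^sup>2 + (y i)\<^sup>2"
    have "N \<le> (N + V) / 2 + \<epsilon> * (- (\<kappa> / 2) * N + P / (2 * \<kappa>) + (Q i - Q (i - 1)) + \<delta> * C * E)"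
      using e by (simp add: N_def V_def P_def E_def distrib_left)
    moreover have "2 * (\<epsilon> * (- (\<kappa> / 2) * N + P / (2 * \<kappa>) + (Q i - Q (i - 1)) + \<delta> * C * E))
        = - (\<epsilon> * \<kappa> * N) + \<epsilon> / \<kappa> * P + 2 * \<epsilon> * Q i - 2 * \<epsilon> * Q (i - 1) + (2 * \<epsilon> * (\<delta> * C)) * E"
      using \<kappa>_pos by (simp add: field_simps)
    moreover have "n + a + q' \<le> v + b + q + d"
      if "n \<le> (n + v) / 2 + z" "2 * z = - a + b + q - q' + d" for n v z a b q q' d :: real
      using that by (simp add: field_simps)
    ultimately have "(1 + \<epsilon> * \<kappa>) * N + 2 * \<epsilon> * Q (i - 1)
        \<le> V + \<epsilon> / \<kappa> * P + 2 * \<epsilon> * Q i + (2 * \<epsilon> * (\<delta> * C)) * E"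
      unfolding distrib_right mult_1_left by blast
    then show ?thesis unfolding N_def V_def P_def E_def .
  qed
  let ?l = "\<lambda>i. (1 + \<epsilon> * \<kappa>) * (\<theta> i * (y i)\<^sup>2) + 2 * \<epsilon> * Q (i - 1)"
  let ?r = "\<lambda>i. \<theta> i * (coord v i)\<^sup>2 + \<epsilon> / \<kappa> * (\<theta> i * (coord f i)\<^sup>2) + 2 * \<epsilon> * Q i
        + (2 * \<epsilon> * (\<delta> * C)) * ((y (i - 1))\<^sup>2 + (y i)\<^sup>2)"
  have ws: "((\<lambda>i. \<theta> i * (coord z i)\<^sup>2) has_sum wsum \<theta> z) UNIV" for z
    unfolding wsum_def by (intro has_sum_infsum wsum_summable[OF \<theta>])
  have Q1: "(Q has_sum infsum Q UNIV) UNIV" using Qs by (rule has_sum_infsum)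
  have Q2: "((\<lambda>i. Q (i - 1)) has_sum infsum Q UNIV) UNIV"
    using has_sum_infsum[OF Qs'(1)] Qs'(2) by simp
  have Y1: "((\<lambda>i. (y i)\<^sup>2) has_sum (norm u)\<^sup>2) UNIV"
    using has_sum_infsum[OF y2] by (simp add: norm_ell2_square y_def)
  have Y2: "((\<lambda>i. (y (i - 1))\<^sup>2) has_sum (norm u)\<^sup>2) UNIV"
    using has_sum_infsum[OF y2'(1)] y2'(2) by (simp add: norm_ell2_square y_def)
  have "(?l has_sum ((1 + \<epsilon> * \<kappa>) * wsum \<theta> u + 2 * \<epsilon> * infsum Q UNIV)) UNIV"
    using ws[of u] by (intro has_sum_add has_sum_cmult_right Q2) (simp add: y_def)
  moreover have "(?r has_sum (wsum \<theta> v + \<epsilon> / \<kappa> * wsum \<theta> f + 2 * \<epsilon> * infsum Q UNIV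
      + (2 * \<epsilon> * (\<delta> * C)) * ((norm u)\<^sup>2 + (norm u)\<^sup>2))) UNIV"
    by (intro has_sum_add has_sum_cmult_right Q1 ws Y1 Y2)
  ultimately have "(1 + \<epsilon> * \<kappa>) * wsum \<theta> u + 2 * \<epsilon> * infsum Q UNIV
      \<le> wsum \<theta> v + \<epsilon> / \<kappa> * wsum \<theta> f + 2 * \<epsilon> * infsum Q UNIV
        + (2 * \<epsilon> * (\<delta> * C)) * ((norm u)\<^sup>2 + (norm u)\<^sup>2)"
    by (rule has_sum_mono) (rule site)
  moreover have "(2 * \<epsilon> * (\<delta> * C)) * ((norm u)\<^sup>2 + (norm u)\<^sup>2) \<le> (2 * \<epsilon> * (\<delta> * C)) * (R\<^sup>2 + R\<^sup>2)"
    using \<epsilon> \<delta>0 C0 R by (intro mult_left_mono add_mono power_mono) auto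
  moreover have "(2 * \<epsilon> * (\<delta> * C)) * (R\<^sup>2 + R\<^sup>2) = \<epsilon> * (\<delta> * (2 * \<nu> + 4 * \<alpha> * R / 3) * R\<^sup>2)"
    by (simp add: C_def algebra_simps)
  ultimately have "(1 + \<epsilon> * \<kappa>) * wsum \<theta> u
      \<le> wsum \<theta> v + \<epsilon> / \<kappa> * wsum \<theta> f + \<epsilon> * (\<delta> * (2 * \<nu> + 4 * \<alpha> * R / 3) * R\<^sup>2)"
    by linarith
  then show ?thesis by (simp add: distrib_left)
qed

end


section \<open>Implicit Euler steps\<close>

text \<open>All iterates lie in \<open>B\<close>, so \<open>G\<close> matters only there. This
  allows replacing \<open>Ftrunc\<close> by the lattice operator, with agreement known only on
  \<open>vecs m\<close>.\<close>

lemma implicit_euler_cong: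
  fixes G G' :: "'a::real_vector \<Rightarrow> 'a"
  assumes "\<And>x. x \<in> B \<Longrightarrow> G x = G' x"
  shows "implicit_euler G B \<epsilon> = implicit_euler G' B \<epsilon>"
proof -
  have "(\<lambda>u :: nat \<Rightarrow> 'a. u 0 = y \<and> (\<forall>k\<ge>1. u k = u (k - 1) + \<epsilon> *\<^sub>R G (u k)) \<and> (\<forall>k. u k \<in> B)) =
      (\<lambda>u. u 0 = y \<and> (\<forall>k\<ge>1. u k = u (k - 1) + \<epsilon> *\<^sub>R G' (u k)) \<and> (\<forall>k. u k \<in> B))" for y
    using assms by (intro ext) metis
  then show ?thesis unfolding implicit_euler_def by (simp only:)
qed

text \<open>Unique solvability of one step gives, by induction, a unique orbit in \<open>B\<close>,
  so the definite description in \<open>implicit_euler\<close> denotes it.\<close>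

lemma implicit_euler_solution:
  fixes G :: "'a::real_vector \<Rightarrow> 'a"
  assumes solv: "\<And>v. v \<in> B \<Longrightarrow> \<exists>!u. u \<in> B \<and> u = v + \<epsilon> *\<^sub>R G u" and y: "y \<in> B"
  shows "implicit_euler G B \<epsilon> 0 y = y" "implicit_euler G B \<epsilon> n y \<in> B"
    "implicit_euler G B \<epsilon> (Suc n) y
      = implicit_euler G B \<epsilon> n y + \<epsilon> *\<^sub>R G (implicit_euler G B \<epsilon> (Suc n) y)"
proof -
  let ?P = "\<lambda>u :: nat \<Rightarrow> 'a.
    u 0 = y \<and> (\<forall>k\<ge>1. u k = u (k - 1) + \<epsilon> *\<^sub>R G (u k)) \<and> (\<forall>k. u k \<in> B)"
  define st where "st v = (THE u. u \<in> B \<and> u = v + \<epsilon> *\<^sub>R G u)" for v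
  have st: "st v \<in> B" "st v = v + \<epsilon> *\<^sub>R G (st v)" if "v \<in> B" for v
    using theI'[OF solv[OF that]] unfolding st_def by auto
  define w where "w k = (st ^^ k) y" for k
  have wB: "w k \<in> B" for k
    by (induction k) (auto simp: w_def y st(1))
  have rec: "u (Suc k) = u k + \<epsilon> *\<^sub>R G (u (Suc k))" if "?P u" for u k
  proof -
    from that have "\<And>k. 1 \<le> k \<Longrightarrow> u k = u (k - 1) + \<epsilon> *\<^sub>R G (u k)" by blast
    from this[of "Suc k"] have "u (Suc k) = u (Suc k - 1) + \<epsilon> *\<^sub>R G (u (Suc k))" by simp
    then show ?thesis unfolding diff_Suc_1 .
  qed
  have "\<exists>!u. ?P u"
  proof
    show "?P w"
    proof (intro conjI allI impI)
      fix k :: nat assume "1 \<le> k"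
      then obtain j where "k = Suc j" by (cases k) auto
      then show "w k = w (k - 1) + \<epsilon> *\<^sub>R G (w k)"
        using st(2)[OF wB[of j]] by (simp add: w_def)
    qed (use wB in \<open>auto simp: w_def\<close>)
  next
    fix u assume u: "?P u"
    have "u k = w k" for k
    proof (induction k)
      case 0
      then show ?case using u by (simp add: w_def)
    next
      case (Suc k)
      have "u (Suc k) = u k + \<epsilon> *\<^sub>R G (u (Suc k))" by (rule rec[OF u])
      moreover have "u (Suc k) \<in> B" "u k \<in> B" using u by auto
      moreover have "w (Suc k) = w k + \<epsilon> *\<^sub>R G (w (Suc k))"
        using st(2)[OF wB[of k]] by (simp add: w_def)
      ultimately show ?case using Suc.IH solv[OF \<open>u k \<in> B\<close>] wB[of "Suc k"] by metis
    qed
    then show "u = w" by blast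
  qed
  from theI'[OF this] have *: "?P (\<lambda>n. implicit_euler G B \<epsilon> n y)"
    unfolding implicit_euler_def .
  then show "implicit_euler G B \<epsilon> 0 y = y" "implicit_euler G B \<epsilon> n y \<in> B" by auto
  show "implicit_euler G B \<epsilon> (Suc n) y
      = implicit_euler G B \<epsilon> n y + \<epsilon> *\<^sub>R G (implicit_euler G B \<epsilon> (Suc n) y)"
    by (rule rec[OF *])
qed

lemma slow_weight_one: "slow_weight 0 (\<lambda>_. 1)"
  by (simp add: slow_weight_def)

lemma norm_trunc_le: "norm (trunc m f) \<le> norm f"
proof -
  have "norm (trunc m f) \<le> norm (abs_ell2 f)"
    by (rule norm_ell2_mono) (simp add: trunc.rep_eq abs_ell2.rep_eq)
  then show ?thesis by simp
qed

section \<open>Solvability of one step and the limit set of the orbits\<close>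

context dissipative_lattice
begin

text \<open>By \<open>M\<close> a step moves a point by at most \<open>1\<close>, so the fixed point
  map sends the ball of radius \<open>r + 1\<close> to itself; by \<open>L\<close> it contracts
  there. The energy inequality puts the fixed point back into radius \<open>r\<close>, using
  \<open>norm f \<le> \<kappa> * r\<close>.\<close>

lemma implicit_step_solvable:
  assumes f: "norm f \<le> \<kappa> * r" and \<epsilon>: "0 < \<epsilon>"
    and M: "\<epsilon> * M_const \<alpha> \<beta> \<nu> \<gamma> lam f (r + 1) \<le> 1"
    and L: "\<epsilon> * (1 + L_const \<alpha> \<beta> \<nu> \<gamma> lam (r + 1)) \<le> 1"
    and v: "v \<in> cball 0 r \<inter> ell2_on S"
  shows "\<exists>!u. u \<in> cball 0 r \<inter> ell2_on S \<and> u = v + \<epsilon> *\<^sub>R G S f u"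
proof -
  define D where "D = cball 0 (r + 1) \<inter> ell2_on S"
  have vr: "norm v \<le> r" using v by simp
  have r0: "0 \<le> r" using vr norm_ge_zero order_trans by blast
  have nn: "0 \<le> \<alpha>" "0 \<le> \<beta>" "0 \<le> \<nu>" "0 \<le> \<gamma>" "0 \<le> lam" using pos lam_pos by auto
  have L0: "0 \<le> L_const \<alpha> \<beta> \<nu> \<gamma> lam (r + 1)"
    unfolding L_const_def using nn r0 by (intro add_nonneg_nonneg mult_nonneg_nonneg) auto
  have ex: "\<exists>!u\<in>D. v + \<epsilon> *\<^sub>R G S f u = u"
  proof (rule Banach_fix)
    show "complete D"
      unfolding D_def complete_eq_closed by (intro closed_Int closed_cball closed_ell2_on)
    have "v \<in> D" using v by (auto simp: D_def)
    then show "D \<noteq> {}" by blast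
    show "0 \<le> \<epsilon> * L_const \<alpha> \<beta> \<nu> \<gamma> lam (r + 1)" using \<epsilon> L0 by simp
    \<comment> \<open>The summand \<open>1\<close> next to \<open>L_const\<close> in the hypothesis
      makes this strict: the left side is at most \<open>1 - \<epsilon>\<close>.\<close>
    show "\<epsilon> * L_const \<alpha> \<beta> \<nu> \<gamma> lam (r + 1) < 1" using \<epsilon> L by (simp add: distrib_left)
    show "(\<lambda>u. v + \<epsilon> *\<^sub>R G S f u) ` D \<subseteq> D"
    proof clarify
      fix u assume u: "u \<in> D"
      have "norm (\<epsilon> *\<^sub>R G S f u) \<le> \<epsilon> * M_const \<alpha> \<beta> \<nu> \<gamma> lam f (r + 1)"
        using u \<epsilon> nn by (intro norm_scaleR_le lattice_op_growth) (auto simp: D_def)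
      then have "norm (v + \<epsilon> *\<^sub>R G S f u) \<le> r + 1"
        using norm_triangle_ineq[of v "\<epsilon> *\<^sub>R G S f u"] M vr by linarith
      then show "v + \<epsilon> *\<^sub>R G S f u \<in> D"
        using v by (auto simp: D_def ell2_on_def lattice_op.rep_eq)
    qed
    fix x y assume xy: "x \<in> D" "y \<in> D"
    have "dist (v + \<epsilon> *\<^sub>R G S f x) (v + \<epsilon> *\<^sub>R G S f y) = norm (\<epsilon> *\<^sub>R (G S f x - G S f y))"
      by (simp add: dist_norm scaleR_diff_right)
    also have "\<dots> \<le> \<epsilon> * (L_const \<alpha> \<beta> \<nu> \<gamma> lam (r + 1) * norm (x - y))"
      using xy \<epsilon> nn by (intro norm_scaleR_le lattice_op_lipschitz) (auto simp: D_def)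
    finally show "dist (v + \<epsilon> *\<^sub>R G S f x) (v + \<epsilon> *\<^sub>R G S f y)
        \<le> \<epsilon> * L_const \<alpha> \<beta> \<nu> \<gamma> lam (r + 1) * dist x y"
      by (simp add: dist_norm)
  qed
  have small: "norm u \<le> r" if u: "u \<in> D" "u = v + \<epsilon> *\<^sub>R G S f u" for u
  proof -
    \<comment> \<open>The constant weight has \<open>\<delta> = 0\<close>, so the a priori radius
      \<open>r + 1\<close> drops out of the estimate.\<close>
    have "(1 + \<epsilon> * \<kappa>) * (norm u)\<^sup>2 \<le> (norm v)\<^sup>2 + \<epsilon> * ((norm f)\<^sup>2 / \<kappa>)"
      using energy_step[OF u(2) _ _ \<epsilon> slow_weight_one, of "r + 1"] u(1)
      by (simp add: wsum_one D_def)
    also have "\<dots> \<le> r\<^sup>2 + \<epsilon> * ((\<kappa> * r)\<^sup>2 / \<kappa>)"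
      using vr f \<epsilon> \<kappa>_pos by (intro add_mono mult_left_mono divide_right_mono power_mono) auto
    also have "\<dots> = (1 + \<epsilon> * \<kappa>) * r\<^sup>2"
      using \<kappa>_pos by (simp add: power2_eq_square field_simps)
    finally have "(norm u)\<^sup>2 \<le> r\<^sup>2"
      using \<epsilon> \<kappa>_pos by (simp add: add_pos_pos)
    then show ?thesis using r0 by (rule power2_le_imp_le)
  qed
  have sub: "cball 0 r \<inter> ell2_on S \<subseteq> D" by (auto simp: D_def)
  from ex obtain u where u: "u \<in> D" "v + \<epsilon> *\<^sub>R G S f u = u" by blast
  show ?thesis
  proof
    show "u \<in> cball 0 r \<inter> ell2_on S \<and> u = v + \<epsilon> *\<^sub>R G S f u"
      using small[OF u(1) u(2)[symmetric]] u by (simp add: D_def)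
    fix u' assume "u' \<in> cball 0 r \<inter> ell2_on S \<and> u' = v + \<epsilon> *\<^sub>R G S f u'"
    then show "u' = u" using ex u sub by (metis subsetD)
  qed
qed

text \<open>\<open>K\<close> covers both index ranges occurring in the attractors, all naturals and
  those from \<open>1\<close> on.\<close>

lemma limit_set_properties:
  fixes S :: "int set" and K :: "nat set" and r \<epsilon> :: real and f :: ell2
  assumes f: "norm f \<le> \<kappa> * r" and \<epsilon>: "0 < \<epsilon>" and r0: "0 \<le> r"
    and M: "\<epsilon> * M_const \<alpha> \<beta> \<nu> \<gamma> lam f (r + 1) \<le> 1"
    and L: "\<epsilon> * (1 + L_const \<alpha> \<beta> \<nu> \<gamma> lam (r + 1)) \<le> 1"
    and K: "{1..} \<subseteq> K"
  defines "B \<equiv> cball 0 r \<inter> ell2_on S"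
  defines "U \<equiv> \<lambda>k. \<Union>n\<in>{k..}. implicit_euler (G S f) B \<epsilon> n ` B"
  shows "(\<Inter>k\<in>K. closure (U k)) \<noteq> {}" "(\<Inter>k\<in>K. closure (U k)) \<subseteq> cball 0 (norm f / \<kappa>)"
proof -
  have solv: "\<exists>!u. u \<in> B \<and> u = v + \<epsilon> *\<^sub>R G S f u" if "v \<in> B" for v
    using implicit_step_solvable[OF f \<epsilon> M L] that unfolding B_def by blast
  define E where "E n y = implicit_euler (G S f) B \<epsilon> n y" for n y
  have E: "E 0 y = y" "E n y \<in> B" "E (Suc n) y = E n y + \<epsilon> *\<^sub>R G S f (E (Suc n) y)"
    if "y \<in> B" for n y
    using implicit_euler_solution[OF solv that] unfolding E_def by auto
  have BD: "norm y \<le> r" "y \<in> ell2_on S" if "y \<in> B" for y using that by (auto simp: B_def)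
  have step: "(1 + \<epsilon> * \<kappa>) * wsum \<theta> (E (Suc n) y)
      \<le> wsum \<theta> (E n y) + \<epsilon> * (wsum \<theta> f / \<kappa> + \<delta> * (2 * \<nu> + 4 * \<alpha> * r / 3) * r\<^sup>2)"
    if "y \<in> B" "slow_weight \<delta> \<theta>" for n y \<delta> \<theta>
    using energy_step[OF E(3)[OF that(1)] BD(2) BD(1) \<epsilon> that(2)] E(2)[OF that(1)] by blast
  have q0: "0 < 1 + \<epsilon> * \<kappa>" "1 < 1 + \<epsilon> * \<kappa>" using \<epsilon> \<kappa>_pos by (auto simp: add_pos_pos)

  \<comment> \<open>The fixed point of the recursion for the squared norms; the excess over it
    shrinks by the factor \<open>1 / (1 + \<epsilon> * \<kappa>)\<close> in each step.\<close>
  define b where "b = (norm f)\<^sup>2 / \<kappa>\<^sup>2"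
  have b0: "0 \<le> b" by (simp add: b_def)
  have decay: "(norm (E n y))\<^sup>2 \<le> b + (1 / (1 + \<epsilon> * \<kappa>)) ^ n * r\<^sup>2" if y: "y \<in> B" for n y
  proof (induction n)
    case 0
    have "(norm y)\<^sup>2 \<le> r\<^sup>2" using BD(1)[OF y] by (intro power_mono) auto
    then show ?case using b0 E(1)[OF y] by simp
  next
    case (Suc n)
    have "(1 + \<epsilon> * \<kappa>) * (norm (E (Suc n) y))\<^sup>2 \<le> (norm (E n y))\<^sup>2 + \<epsilon> * ((norm f)\<^sup>2 / \<kappa>)"
      using step[OF y slow_weight_one] by (simp add: wsum_one)
    also have "\<epsilon> * ((norm f)\<^sup>2 / \<kappa>) = \<epsilon> * \<kappa> * b"
      using \<kappa>_pos by (simp add: b_def power2_eq_square)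
    also have "(norm (E n y))\<^sup>2 + \<epsilon> * \<kappa> * b \<le> (1 + \<epsilon> * \<kappa>) * b + (1 / (1 + \<epsilon> * \<kappa>)) ^ n * r\<^sup>2"
      using Suc.IH by (simp add: distrib_right)
    also have "\<dots> = (1 + \<epsilon> * \<kappa>) * (b + (1 / (1 + \<epsilon> * \<kappa>)) ^ Suc n * r\<^sup>2)"
      using q0 by (simp add: distrib_left)
    finally show ?case using q0 by simp
  qed
  show "(\<Inter>k\<in>K. closure (U k)) \<subseteq> cball 0 (norm f / \<kappa>)"
  proof
    fix l assume l: "l \<in> (\<Inter>k\<in>K. closure (U k))"
    have "(norm l)\<^sup>2 \<le> b + (1 / (1 + \<epsilon> * \<kappa>)) ^ k * r\<^sup>2" if "1 \<le> k" for k
    proof -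
      \<comment> \<open>The decay bound decreases in \<open>n\<close>, so its value at
        \<open>k\<close> serves for all of \<open>U k\<close> and, the ball being closed, for the
        closure.\<close>
      define c where "c = b + (1 / (1 + \<epsilon> * \<kappa>)) ^ k * r\<^sup>2"
      have c0: "0 \<le> c" using b0 q0 by (simp add: c_def)
      have "U k \<subseteq> cball 0 (sqrt c)"
      proof (clarsimp simp: U_def E_def[symmetric])
        fix n y assume n: "k \<le> n" and y: "y \<in> B"
        have "(norm (E n y))\<^sup>2 \<le> b + (1 / (1 + \<epsilon> * \<kappa>)) ^ n * r\<^sup>2" by (rule decay[OF y])
        also have "\<dots> \<le> c"
          unfolding c_def using n q0 by (intro add_left_mono mult_right_mono power_decreasing) auto
        finally show "norm (E n y) \<le> sqrt c" by (rule real_le_rsqrt)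
      qed
      then have "closure (U k) \<subseteq> cball 0 (sqrt c)" by (rule closure_minimal) simp
      moreover have "k \<in> K" using that K by auto
      then have "l \<in> closure (U k)" using l by blast
      ultimately have "norm l \<le> sqrt c" by auto
      then have "(norm l)\<^sup>2 \<le> (sqrt c)\<^sup>2" by (intro power_mono) auto
      then show ?thesis using c0 by (simp add: c_def[symmetric])
    qed
    moreover have "(\<lambda>k. b + (1 / (1 + \<epsilon> * \<kappa>)) ^ k * r\<^sup>2) \<longlonglongrightarrow> b + 0 * r\<^sup>2"
      using q0 by (intro tendsto_intros LIMSEQ_realpow_zero) auto
    ultimately have "(norm l)\<^sup>2 \<le> b + 0 * r\<^sup>2" by (intro LIMSEQ_le_const) blast+
    then have "(norm l)\<^sup>2 \<le> (norm f / \<kappa>)\<^sup>2" by (simp add: b_def power_divide)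
    then have "norm l \<le> norm f / \<kappa>" using \<kappa>_pos by (intro power2_le_imp_le[of "norm l"]) auto
    then show "l \<in> cball 0 (norm f / \<kappa>)" by simp
  qed

  have zB: "0 \<in> B" using r0 by (simp add: B_def ell2_on_def)
  define C where "C = (2 * \<nu> + 4 * \<alpha> * r / 3) * r\<^sup>2"
  have C0: "0 \<le> C" using pos r0 by (simp add: C_def)
  \<comment> \<open>Starting at \<open>0\<close>, the initial weighted energy vanishes, so the bound holds for every \<open>n\<close>.\<close>
  have tail: "wsum \<theta> (E n 0) \<le> wsum \<theta> f / \<kappa>\<^sup>2 + \<delta> * C / \<kappa>" if \<theta>: "slow_weight \<delta> \<theta>" for n \<theta> \<delta>
  proof (induction n)
    case 0
    have "0 \<le> \<delta>" using \<theta> by (auto simp: slow_weight_def intro: order_trans[OF abs_ge_zero])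
    then show ?case
      using wsum_nonneg[OF \<theta>] C0 \<kappa>_pos E(1)[OF zB] by (simp add: wsum_def)
  next
    case (Suc n)
    \<comment> \<open>Again the fixed point of the recursion; starting below it, the orbit stays
      below.\<close>
    define \<eta> where "\<eta> = wsum \<theta> f / \<kappa>\<^sup>2 + \<delta> * C / \<kappa>"
    have "(1 + \<epsilon> * \<kappa>) * wsum \<theta> (E (Suc n) 0) \<le> wsum \<theta> (E n 0) + \<epsilon> * (wsum \<theta> f / \<kappa> + \<delta> * C)"
      using step[OF zB \<theta>] by (simp add: C_def mult.assoc)
    also have "\<epsilon> * (wsum \<theta> f / \<kappa> + \<delta> * C) = \<epsilon> * \<kappa> * \<eta>"
      using \<kappa>_pos by (simp add: \<eta>_def power2_eq_square field_simps)
    also have "wsum \<theta> (E n 0) + \<epsilon> * \<kappa> * \<eta> \<le> (1 + \<epsilon> * \<kappa>) * \<eta>"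
      using Suc.IH by (simp add: \<eta>_def[symmetric] distrib_right)
    finally show ?case using q0 by (simp add: \<eta>_def)
  qed
  have tails: "\<exists>k>0. \<forall>n. wsum (tail_weight k) (E n 0) \<le> e" if "e > 0" for e
  proof -
    obtain K where K: "\<And>k. k > K \<Longrightarrow> wsum (tail_weight k) f < e * \<kappa>\<^sup>2 / 2"
      using wsum_tail_small[of "e * \<kappa>\<^sup>2 / 2" f] \<open>e > 0\<close> \<kappa>_pos by auto
    \<comment> \<open>\<open>K + 1\<close> handles the tail of the force,
      \<open>2 * C / (\<kappa> * e)\<close> the error of the ramp with slope \<open>1 / k\<close>,
      and \<open>1\<close> the sign. None of them depends on \<open>n\<close>.\<close>
    define k where "k = max (K + 1) (max 1 (2 * C / (\<kappa> * e)))"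
    have k: "k > K" "k > 0" "2 * C / (\<kappa> * e) \<le> k" by (auto simp: k_def)
    have "wsum (tail_weight k) f / \<kappa>\<^sup>2 \<le> e / 2"
      using K[OF k(1)] \<kappa>_pos by (simp add: divide_le_eq)
    moreover have "1 / k * C / \<kappa> \<le> e / 2"
      using k \<kappa>_pos \<open>e > 0\<close> by (simp add: field_simps)
    ultimately have "wsum (tail_weight k) (E n 0) \<le> e" for n
      using tail[OF slow_weight_tail[OF k(2)], of n] by linarith
    then show ?thesis using k(2) by blast
  qed
  have bdd: "norm (E n 0) \<le> r" for n by (rule BD(1)[OF E(2)[OF zB]])
  obtain l s where s: "strict_mono s" "(\<lambda>n. E (s n) 0) \<longlonglongrightarrow> l"
    by (rule uniform_tails_convergent_subsequence[of "\<lambda>n. E n 0" r, OF bdd tails])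
  \<comment> \<open>One limit serves every \<open>k\<close>: dropping the first \<open>k\<close>
    members of the subsequence leaves indices \<open>s (n + k) \<ge> k\<close>.\<close>
  have "l \<in> closure (U k)" for k
    unfolding closure_sequential
  proof (intro exI conjI allI)
    show "(\<lambda>n. E (s (n + k)) 0) \<longlonglongrightarrow> l" using s(2) by (rule LIMSEQ_ignore_initial_segment)
    fix n
    have "k \<le> s (n + k)" using seq_suble[OF s(1), of "n + k"] by linarith
    then show "E (s (n + k)) 0 \<in> U k" using zB by (auto simp: U_def E_def)
  qed
  then show "(\<Inter>k\<in>K. closure (U k)) \<noteq> {}" by blast
qed

text \<open>Here \<open>f\<close> fixes the radius and the step bound, while \<open>g\<close> is the
  acting force, either \<open>f\<close> or \<open>trunc m f\<close>. \<open>M_const\<close> is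
  monotone in the norm of the force and \<open>L_const\<close> does not contain it; moreover
  \<open>\<kappa> * r = \<kappa> + norm f\<close>.\<close>

lemma admissible_step:
  assumes "\<epsilon> \<in> {0<..eps_star \<alpha> \<beta> \<nu> \<gamma> lam f}" and g: "norm g \<le> norm f"
  defines "r \<equiv> r_star \<alpha> \<beta> \<nu> \<gamma> lam f"
  shows "0 < \<epsilon>" "0 \<le> r" "norm g \<le> \<kappa> * r"
    "\<epsilon> * M_const \<alpha> \<beta> \<nu> \<gamma> lam g (r + 1) \<le> 1" "\<epsilon> * (1 + L_const \<alpha> \<beta> \<nu> \<gamma> lam (r + 1)) \<le> 1"
proof -
  have r: "r = 1 + norm f / \<kappa>" by (simp add: r_def r_star_def \<kappa>_def)
  show \<epsilon>: "0 < \<epsilon>" using assms(1) by simp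
  show r0: "0 \<le> r" using \<kappa>_pos by (simp add: r)
  show "norm g \<le> \<kappa> * r" using g \<kappa>_pos by (simp add: r distrib_left)
  have "0 < M_const \<alpha> \<beta> \<nu> \<gamma> lam f (r + 1)"
    unfolding M_const_def using pos lam_pos r0 by (intro add_pos_nonneg add_pos_pos mult_pos_pos) auto
  moreover have "0 < 1 + L_const \<alpha> \<beta> \<nu> \<gamma> lam (r + 1)"
    unfolding L_const_def using pos lam_pos r0
    by (intro add_pos_nonneg add_nonneg_nonneg mult_nonneg_nonneg) auto
  moreover have "\<epsilon> \<le> 1 / M_const \<alpha> \<beta> \<nu> \<gamma> lam f (r + 1)"
    "\<epsilon> \<le> 1 / (1 + L_const \<alpha> \<beta> \<nu> \<gamma> lam (r + 1))"
    using assms(1) by (auto simp: eps_star_def r_def)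
  ultimately have M: "\<epsilon> * M_const \<alpha> \<beta> \<nu> \<gamma> lam f (r + 1) \<le> 1"
    and L: "\<epsilon> * (1 + L_const \<alpha> \<beta> \<nu> \<gamma> lam (r + 1)) \<le> 1"
    by (simp_all only: le_divide_eq if_True)
  show "\<epsilon> * (1 + L_const \<alpha> \<beta> \<nu> \<gamma> lam (r + 1)) \<le> 1" by (rule L)
  have "\<epsilon> * M_const \<alpha> \<beta> \<nu> \<gamma> lam g (r + 1) \<le> \<epsilon> * M_const \<alpha> \<beta> \<nu> \<gamma> lam f (r + 1)"
    using \<epsilon> g by (intro mult_left_mono) (auto simp: M_const_def)
  then show "\<epsilon> * M_const \<alpha> \<beta> \<nu> \<gamma> lam g (r + 1) \<le> 1" using M by linarith
qed

lemma numerical_attractor_bounds: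
  assumes "\<epsilon> \<in> {0<..eps_star \<alpha> \<beta> \<nu> \<gamma> lam f}"
  shows "numerical_attractor \<alpha> \<beta> \<nu> \<gamma> lam f \<epsilon> \<noteq> {}"
    "numerical_attractor \<alpha> \<beta> \<nu> \<gamma> lam f \<epsilon> \<subseteq> cball 0 (norm f / \<kappa>)"
proof -
  have "G UNIV f = F \<alpha> \<beta> \<nu> \<gamma> lam f" by (rule ext) (rule lattice_op_UNIV)
  note * = limit_set_properties[OF admissible_step(3,1,2,4,5)[OF assms order_refl] subset_UNIV,
      of UNIV, unfolded this ell2_on_UNIV Int_UNIV_right]
  show "numerical_attractor \<alpha> \<beta> \<nu> \<gamma> lam f \<epsilon> \<noteq> {}"
    using *(1) unfolding numerical_attractor_def Let_def .
  show "numerical_attractor \<alpha> \<beta> \<nu> \<gamma> lam f \<epsilon> \<subseteq> cball 0 (norm f / \<kappa>)"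
    using *(2) unfolding numerical_attractor_def Let_def .
qed

lemma truncated_attractor_bounds:
  assumes "\<epsilon> \<in> {0<..eps_star \<alpha> \<beta> \<nu> \<gamma> lam f}"
  shows "truncated_attractor m \<alpha> \<beta> \<nu> \<gamma> lam f \<epsilon> \<noteq> {}"
    "truncated_attractor m \<alpha> \<beta> \<nu> \<gamma> lam f \<epsilon> \<subseteq> cball 0 (norm (trunc m f) / \<kappa>)"
proof -
  define B where "B = cball 0 (r_star \<alpha> \<beta> \<nu> \<gamma> lam f) \<inter> vecs m"
  have "implicit_euler (G {- int m..int m} (trunc m f)) B \<epsilon>
      = implicit_euler (Ftrunc m \<alpha> \<beta> \<nu> \<gamma> lam f) B \<epsilon>"
    by (rule implicit_euler_cong) (simp add: B_def lattice_op_interval)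
  note * = limit_set_properties[OF admissible_step(3,1,2,4,5)[OF assms norm_trunc_le[of m]] order_refl,
      of "{- int m..int m}", unfolded ell2_on_interval B_def[symmetric] this]
  show "truncated_attractor m \<alpha> \<beta> \<nu> \<gamma> lam f \<epsilon> \<noteq> {}"
    using *(1) unfolding truncated_attractor_def Let_def B_def[symmetric] .
  show "truncated_attractor m \<alpha> \<beta> \<nu> \<gamma> lam f \<epsilon> \<subseteq> cball 0 (norm (trunc m f) / \<kappa>)"
    using *(2) unfolding truncated_attractor_def Let_def B_def[symmetric] .
qed

end


section \<open>Distances to the origin\<close>

text \<open>The distance from \<open>{0}\<close> to \<open>A\<close> is controlled by a single point
  of \<open>A\<close>; this is where nonemptiness enters.\<close>

lemma set_norm_le:
  assumes "A \<noteq> {}" "A \<subseteq> cball 0 c"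
  shows "set_norm A \<le> ennreal c"
proof -
  obtain a where a: "a \<in> A" using assms(1) by blast
  have c: "norm x \<le> c" if "x \<in> A" for x using assms(2) that by auto
  have "semidist A {0} \<le> ennreal c"
    unfolding semidist_def by (auto intro!: SUP_least ennreal_leI c)
  moreover have "semidist {0} A \<le> ennreal (norm (0 - a))"
    unfolding semidist_def by (simp, rule INF_lower2[OF a]) simp
  moreover have "ennreal (norm (0 - a)) \<le> ennreal c"
    using c[OF a] by (simp add: ennreal_leI)
  ultimately show ?thesis unfolding set_norm_def hausdorff_def by auto
qed

text \<open>In its uses the radius \<open>c\<close> is free of the step size, so one bound covers
  every admissible choice of steps along the filter.\<close>

lemma tendsto_hausdorff_zero:
  assumes "(c \<longlongrightarrow> 0) Fl" "eventually (\<lambda>x. A x \<noteq> {} \<and> A x \<subseteq> cball 0 (c x)) Fl"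
  shows "((\<lambda>x. hausdorff (A x) {0}) \<longlongrightarrow> 0) Fl"
proof (rule tendsto_sandwich[where f = "\<lambda>_. 0"])
  show "eventually (\<lambda>x. hausdorff (A x) {0} \<le> ennreal (c x)) Fl"
    using assms(2) by eventually_elim (use set_norm_le in \<open>auto simp: set_norm_def\<close>)
  show "((\<lambda>x. ennreal (c x)) \<longlongrightarrow> 0) Fl"
    using tendsto_ennrealI[OF assms(1)] by simp
qed auto

theorem theorem4p3:
  fixes \<alpha> \<beta> \<nu> \<gamma> :: real
  assumes "\<alpha> > 0" and "\<beta> > 0" and "\<nu> > 0" and "0 < \<gamma>" and "\<gamma> < 1"
  shows
    "(\<forall>f lam \<epsilon>. lam > lambda_star \<alpha> \<beta> \<nu> \<gamma> \<and> \<epsilon> \<in> {0<..eps_star \<alpha> \<beta> \<nu> \<gamma> lam f} \<longrightarrow>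
        set_norm (numerical_attractor \<alpha> \<beta> \<nu> \<gamma> lam f \<epsilon>)
          \<le> ennreal (norm f / (lam - lambda_star \<alpha> \<beta> \<nu> \<gamma>)) \<and>
        (\<forall>m. set_norm (truncated_attractor m \<alpha> \<beta> \<nu> \<gamma> lam f \<epsilon>)
          \<le> ennreal (norm (trunc m f) / (lam - lambda_star \<alpha> \<beta> \<nu> \<gamma>))))
   \<and> (\<forall>lam \<epsilon>. lam > lambda_star \<alpha> \<beta> \<nu> \<gamma> \<and> \<epsilon> \<in> {0<..eps_star \<alpha> \<beta> \<nu> \<gamma> lam 0} \<longrightarrow>
        numerical_attractor \<alpha> \<beta> \<nu> \<gamma> lam 0 \<epsilon> = {0} \<and>
        (\<forall>m. truncated_attractor m \<alpha> \<beta> \<nu> \<gamma> lam 0 \<epsilon> = {0}))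
   \<and> (\<forall>lam (\<epsilon> :: ell2 \<Rightarrow> real).
        lam > lambda_star \<alpha> \<beta> \<nu> \<gamma> \<and> (\<forall>f. \<epsilon> f \<in> {0<..eps_star \<alpha> \<beta> \<nu> \<gamma> lam f}) \<longrightarrow>
        ((\<lambda>f. hausdorff (numerical_attractor \<alpha> \<beta> \<nu> \<gamma> lam f (\<epsilon> f)) {0}) \<longlongrightarrow> 0) (at 0) \<and>
        (\<forall>m. ((\<lambda>f. hausdorff (truncated_attractor m \<alpha> \<beta> \<nu> \<gamma> lam f (\<epsilon> f)) {0}) \<longlongrightarrow> 0) (at 0)))
   \<and> (\<forall>f (\<epsilon> :: real \<Rightarrow> real).
        (\<forall>lam>lambda_star \<alpha> \<beta> \<nu> \<gamma>. \<epsilon> lam \<in> {0<..eps_star \<alpha> \<beta> \<nu> \<gamma> lam f}) \<longrightarrow>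
        ((\<lambda>lam. hausdorff (numerical_attractor \<alpha> \<beta> \<nu> \<gamma> lam f (\<epsilon> lam)) {0}) \<longlongrightarrow> 0) at_top \<and>
        (\<forall>m. ((\<lambda>lam. hausdorff (truncated_attractor m \<alpha> \<beta> \<nu> \<gamma> lam f (\<epsilon> lam)) {0}) \<longlongrightarrow> 0) at_top))"
proof -
  let ?s = "lambda_star \<alpha> \<beta> \<nu> \<gamma>"
  have lat: "dissipative_lattice \<alpha> \<beta> \<nu> \<gamma> lam" if "lam > ?s" for lam
    using assms that by unfold_locales
  note kdef = dissipative_lattice.\<kappa>_def[OF lat]
  have num: "numerical_attractor \<alpha> \<beta> \<nu> \<gamma> lam f \<epsilon> \<noteq> {}"
    "numerical_attractor \<alpha> \<beta> \<nu> \<gamma> lam f \<epsilon> \<subseteq> cball 0 (norm f / (lam - ?s))"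
    if "lam > ?s" "\<epsilon> \<in> {0<..eps_star \<alpha> \<beta> \<nu> \<gamma> lam f}" for f lam \<epsilon>
    using dissipative_lattice.numerical_attractor_bounds[OF lat[OF that(1)] that(2)]
    unfolding kdef[OF that(1)] by auto
  have tru: "truncated_attractor m \<alpha> \<beta> \<nu> \<gamma> lam f \<epsilon> \<noteq> {}"
    "truncated_attractor m \<alpha> \<beta> \<nu> \<gamma> lam f \<epsilon> \<subseteq> cball 0 (norm (trunc m f) / (lam - ?s))"
    if "lam > ?s" "\<epsilon> \<in> {0<..eps_star \<alpha> \<beta> \<nu> \<gamma> lam f}" for f lam \<epsilon> m
    using dissipative_lattice.truncated_attractor_bounds[OF lat[OF that(1)] that(2)]
    unfolding kdef[OF that(1)] by auto
  \<comment> \<open>Enlarging the radius to the full norm of \<open>f\<close> gives every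
    \<open>m\<close> the same vanishing bound as the full attractor.\<close>
  have tru': "truncated_attractor m \<alpha> \<beta> \<nu> \<gamma> lam f \<epsilon> \<subseteq> cball 0 (norm f / (lam - ?s))"
    if "lam > ?s" "\<epsilon> \<in> {0<..eps_star \<alpha> \<beta> \<nu> \<gamma> lam f}" for f lam \<epsilon> m
    using tru(2)[OF that, of m] divide_right_mono[OF norm_trunc_le[of m f], of "lam - ?s"] that(1)
    by (meson cball_subset_cball_iff diff_ge_0_iff_ge less_imp_le order_trans subset_cball)
  have lim_f: "((\<lambda>f :: ell2. norm f / (lam - ?s)) \<longlongrightarrow> 0) (at 0)" if "lam > ?s" for lam
    using that by (auto intro!: tendsto_eq_intros)
  have lim_lam: "((\<lambda>lam. norm f / (lam - ?s)) \<longlongrightarrow> 0) at_top" for f :: ell2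
    by real_asymp
  have large: "eventually (\<lambda>lam. lam > ?s) at_top" by (rule eventually_gt_at_top)
  show ?thesis
  proof (intro conjI allI impI; (elim conjE)?)
    fix f lam \<epsilon> m assume *: "lam > ?s" "\<epsilon> \<in> {0<..eps_star \<alpha> \<beta> \<nu> \<gamma> lam f}"
    show "set_norm (numerical_attractor \<alpha> \<beta> \<nu> \<gamma> lam f \<epsilon>) \<le> ennreal (norm f / (lam - ?s))"
      by (rule set_norm_le[OF num[OF *]])
    show "set_norm (truncated_attractor m \<alpha> \<beta> \<nu> \<gamma> lam f \<epsilon>) \<le> ennreal (norm (trunc m f) / (lam - ?s))"
      by (rule set_norm_le[OF tru[OF *]])
  next
    fix lam \<epsilon> m assume *: "lam > ?s" "\<epsilon> \<in> {0<..eps_star \<alpha> \<beta> \<nu> \<gamma> lam 0}"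
    \<comment> \<open>For \<open>f = 0\<close> the radius is \<open>0\<close>, and a nonempty subset
      of \<open>cball 0 0\<close> is \<open>{0}\<close>.\<close>
    show "numerical_attractor \<alpha> \<beta> \<nu> \<gamma> lam 0 \<epsilon> = {0}" using num[OF *] by auto
    show "truncated_attractor m \<alpha> \<beta> \<nu> \<gamma> lam 0 \<epsilon> = {0}"
      using tru(1)[OF *, of m] tru'[OF *, of m] by auto
  next
    fix lam m and \<epsilon> :: "ell2 \<Rightarrow> real"
    assume *: "lam > ?s" "\<forall>f. \<epsilon> f \<in> {0<..eps_star \<alpha> \<beta> \<nu> \<gamma> lam f}"
    then have **: "\<epsilon> f \<in> {0<..eps_star \<alpha> \<beta> \<nu> \<gamma> lam f}" for f by blast
    show "((\<lambda>f. hausdorff (numerical_attractor \<alpha> \<beta> \<nu> \<gamma> lam f (\<epsilon> f)) {0}) \<longlongrightarrow> 0) (at 0)"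
      by (rule tendsto_hausdorff_zero[OF lim_f[OF *(1)]])
        (intro always_eventually allI conjI num[OF *(1) **])
    show "((\<lambda>f. hausdorff (truncated_attractor m \<alpha> \<beta> \<nu> \<gamma> lam f (\<epsilon> f)) {0}) \<longlongrightarrow> 0) (at 0)"
      by (rule tendsto_hausdorff_zero[OF lim_f[OF *(1)]])
        (intro always_eventually allI conjI tru(1)[OF *(1) **] tru'[OF *(1) **])
  next
    fix f m and \<epsilon> :: "real \<Rightarrow> real"
    assume *: "\<forall>lam>?s. \<epsilon> lam \<in> {0<..eps_star \<alpha> \<beta> \<nu> \<gamma> lam f}"
    show "((\<lambda>lam. hausdorff (numerical_attractor \<alpha> \<beta> \<nu> \<gamma> lam f (\<epsilon> lam)) {0}) \<longlongrightarrow> 0) at_top"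
      by (rule tendsto_hausdorff_zero[OF lim_lam[of f]], rule eventually_mono[OF large])
        (use * num in blast)
    show "((\<lambda>lam. hausdorff (truncated_attractor m \<alpha> \<beta> \<nu> \<gamma> lam f (\<epsilon> lam)) {0}) \<longlongrightarrow> 0) at_top"
      by (rule tendsto_hausdorff_zero[OF lim_lam[of f]], rule eventually_mono[OF large])
        (use * tru(1) tru' in blast)
  qed
qed

end
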